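(* Let $K_1, K_2$ be nonempty compact Hausdorff spaces, let $E$ be a Banach space, and suppose that $T:\mathcal{C}(K_1)\to\mathcal{C}(K_2,E)$ is an isomorphic embedding. Let $\alpha$ be an ordinal and let $n,k\in\mathbb{N}$, $n\ge k$, be such that the set $K_2^{(\omega^{\alpha}k)}$ is infinite. Moreover, let at least one of the following conditions hold: (i) $E$ has nontrivial cotype and $c_{\text{pb}}(K_1^{(\omega^{\alpha}n)},K_1)>c_{\text{pb}}(K_2^{(\omega^{\alpha}k)},K_2)$; (ii) $E$ does not contain an isomorphic copy of $c_0$ and $c_{\text{pb}}(K_1^{(\omega^{\alpha}n)},K_1)>c_{\text{pf}}(K_2^{(\omega^{\alpha}k)},K_2)$. Then $\|T\|\,\|T^{-1}\|\ge\max\left\{3,\frac{2n+2-k}{k}\right\}$.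
   Context: All topological spaces are Hausdorff; $\mathbb{N}$ is the set of positive integers. For a compact space $K$ and a Banach space $E$, $\mathcal{C}(K,E)$ is the Banach space of continuous functions $K\to E$ with the sup-norm, and $\mathcal{C}(K)=\mathcal{C}(K,\mathbb{R})$. An isomorphic embedding $T$ is a bounded linear map that is an isomorphism onto its range; $T^{-1}$ denotes the inverse defined on the range of $T$. Cantor-Bendixson derivatives: $X^{(0)}=X$, $X^{(1)}$ is the set of accumulation points of $X$, $X^{(\beta+1)}=(X^{(\beta)})^{(1)}$, and $X^{(\alpha)}=\bigcap_{\beta<\alpha}X^{(\beta)}$ for limit ordinals $\alpha$. Powers and products of ordinals such as $\omega^{\alpha}k$ are ordinal arithmetic. A family $\mathcal{U}$ of nonempty subsets of a topological space $X$ has order $k\in\mathbb{N}$ if every $x\in X$ lies in at most $k$ sets from $\mathcal{U}$; it is point-bounded if it has order $k$ for some $k\in\mathbb{N}$; it is point-finite if every $x\in X$ lies in only finitely many sets from $\mathcal{U}$. The family $\mathcal{U}$ is meeting $A\subseteq X$ if $A\cap U\ne\emptyset$ for each $U\in\mathcal{U}$. For $A\subseteq X$, $c_{\text{pb}}(A,X)$ (resp. $c_{\text{pf}}(A,X)$) is the supremum of the cardinalities $|\mathcal{U}|$ over all point-bounded (resp. point-finite) families $\mathcal{U}$ of nonempty open subsets of $X$ that are meeting $A$. A Banach space $E$ has nontrivial cotype if there are a real number $q\ge 2$ and a constant $C>0$ such that for all $n\in\mathbb{N}$ and $e_1,\dots,e_n\in E$, $\left(\sum_{i=1}^n\|e_i\|^q\right)^{1/q}\le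 C\left(\int_0^1\left\|\sum_{i=1}^n r_i(t)e_i\right\|^2dt\right)^{1/2}$, where $r_i(t)=\operatorname{sign}(\sin(2^i\pi t))$ are the Rademacher functions. *)

theory Defs
  imports "HOL-Analysis.Analysis"
begin

unbundle cardinal_syntax

section \<open>Ordinals\<close>

text \<open>
  Ordinals are represented by well-orders \<open>r\<close> (reflexive relations with \<open>Well_order r\<close>, as in
  the cardinals library of Main); the ordinal is the order type of \<open>r\<close> on \<open>Field r\<close>. The natural
  number \<open>k\<close> is \<^const>\<open>natLeq_on\<close>\<open> k\<close>.
\<close>

text \<open>
  The power \<open>\<omega>\<^sup>r\<close> as the set of finitely supported functions \<open>Field r \<rightarrow> \<omega>\<close>, compared at the
  largest argument where they differ (Cantor normal form: \<open>f\<close> stands for the sum of the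
  \<open>\<omega>\<^sup>a f(a)\<close>, taken in decreasing order of \<open>a\<close>). Functions are extended by \<open>0\<close> off \<open>Field r\<close>.
\<close>

definition fin_supp_funs :: "'o rel \<Rightarrow> ('o \<Rightarrow> nat) set" where
  "fin_supp_funs r = {f. finite {a. f a \<noteq> 0} \<and> {a. f a \<noteq> 0} \<subseteq> Field r}"

definition omega_power :: "'o rel \<Rightarrow> ('o \<Rightarrow> nat) rel" where
  "omega_power r = {(f, g). f \<in> fin_supp_funs r \<and> g \<in> fin_supp_funs r \<and>
     (f = g \<or> (\<exists>a\<in>Field r. f a < g a \<and> (\<forall>b. (a, b) \<in> r \<and> b \<noteq> a \<longrightarrow> f b = g b)))}"

text \<open>The product \<open>r \<cdot> s\<close> consists of \<open>s\<close> consecutive copies of \<open>r\<close>.\<close>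

definition ord_prod :: "'o rel \<Rightarrow> 'p rel \<Rightarrow> ('o \<times> 'p) rel" where
  "ord_prod r s = {((x, i), (y, j)). x \<in> Field r \<and> y \<in> Field r \<and> i \<in> Field s \<and> j \<in> Field s \<and>
     ((i, j) \<in> s \<and> i \<noteq> j \<or> i = j \<and> (x, y) \<in> r)}"

abbreviation omega_power_times :: "'o rel \<Rightarrow> nat \<Rightarrow> (('o \<Rightarrow> nat) \<times> nat) rel" where
  "omega_power_times r k \<equiv> ord_prod (omega_power r) (natLeq_on k)"


section \<open>Cantor--Bendixson derivatives\<close>

definition accum_points :: "'a::topological_space set \<Rightarrow> 'a set" where
  "accum_points A = {x \<in> A. x islimpt A}"

text \<open>
  An ordinal is identified with the set \<open>S\<close> of its predecessors. Given the derivatives \<open>D c\<close> for all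
  \<open>c \<in> S\<close>, \<open>cb_step\<close> computes the derivative at \<open>S\<close>. The three cases are: \<open>S\<close> is zero; \<open>S\<close> is a
  successor, i.e. it has a largest element; \<open>S\<close> is a limit.
\<close>

definition cb_step :: "'o rel \<Rightarrow> 'a::topological_space set \<Rightarrow> ('o \<Rightarrow> 'a set) \<Rightarrow> 'o set \<Rightarrow> 'a set" where
  "cb_step r X D S =
    (if S = {} then X
     else if \<exists>m\<in>S. \<forall>c\<in>S. (c, m) \<in> r then accum_points (D (THE m. m \<in> S \<and> (\<forall>c\<in>S. (c, m) \<in> r)))
     else (\<Inter>c\<in>S. D c))"

text \<open>
  \<open>cb_deriv_at r X a\<close> is the derivative of \<open>X\<close> whose order is the order type of the initial segment
  strictly below \<open>a \<in> Field r\<close>; \<open>cb_deriv r X\<close> is the one whose order is the order type of \<open>r\<close>.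
\<close>

definition cb_deriv_at :: "'o rel \<Rightarrow> 'a::topological_space set \<Rightarrow> 'o \<Rightarrow> 'a set" where
  "cb_deriv_at r X = wo_rel.worec r (\<lambda>D a. cb_step r X D (underS r a))"

definition cb_deriv :: "'o rel \<Rightarrow> 'a::topological_space set \<Rightarrow> 'a set" where
  "cb_deriv r X = cb_step r X (cb_deriv_at r X) (Field r)"

lemma cb_deriv_at_unfold:
  assumes "Well_order r"
  shows "cb_deriv_at r X a = cb_step r X (cb_deriv_at r X) (underS r a)"
proof -
  have wo: "wo_rel r" by (rule wo_rel.intro[OF assms])
  have "wo_rel.adm_wo r (\<lambda>D a. cb_step r X D (underS r a))"
    unfolding wo_rel.adm_wo_def[OF wo]
  proof (intro allI impI)
    fix D D' :: "'a \<Rightarrow> 'b set" and a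
    assume eq: "\<forall>y\<in>underS r a. D y = D' y"
    have "(THE m. m \<in> underS r a \<and> (\<forall>c\<in>underS r a. (c, m) \<in> r)) \<in> underS r a"
      if "\<exists>m\<in>underS r a. \<forall>c\<in>underS r a. (c, m) \<in> r"
    proof -
      have "\<exists>!m. m \<in> underS r a \<and> (\<forall>c\<in>underS r a. (c, m) \<in> r)"
        using that wo_rel.ANTISYM[OF wo] unfolding antisym_def by blast
      from theI'[OF this] show ?thesis by blast
    qed
    with eq show "cb_step r X D (underS r a) = cb_step r X D' (underS r a)"
      unfolding cb_step_def by auto
  qed
  from fun_cong[OF wo_rel.worec_fixpoint[OF wo this], of a] show ?thesis
    unfolding cb_deriv_at_def .
qed


section \<open>Families of open sets and their cardinalities\<close>

definition has_order :: "'a set set \<Rightarrow> nat \<Rightarrow> bool" where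
  "has_order \<U> k \<longleftrightarrow> (\<forall>x. finite {U \<in> \<U>. x \<in> U} \<and> card {U \<in> \<U>. x \<in> U} \<le> k)"

definition point_bounded :: "'a set set \<Rightarrow> bool" where
  "point_bounded \<U> \<longleftrightarrow> (\<exists>k\<ge>1. has_order \<U> k)"

definition point_finite :: "'a set set \<Rightarrow> bool" where
  "point_finite \<U> \<longleftrightarrow> (\<forall>x. finite {U \<in> \<U>. x \<in> U})"

definition meeting :: "'a set set \<Rightarrow> 'a set \<Rightarrow> bool" where
  "meeting \<U> A \<longleftrightarrow> (\<forall>U\<in>\<U>. A \<inter> U \<noteq> {})"

definition nonempty_open_family :: "'a::topological_space set set \<Rightarrow> bool" where
  "nonempty_open_family \<U> \<longleftrightarrow> (\<forall>U\<in>\<U>. open U \<and> U \<noteq> {})"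

text \<open>
  The supremum of the cardinals \<open>|U|\<close>, \<open>U \<in> F\<close>, is their least upper bound among the cardinals. It is
  bounded by the cardinality of the element type, hence realised by a set of that type.
\<close>

definition card_sup :: "'b set set \<Rightarrow> 'b rel" where
  "card_sup F = |SOME V. (\<forall>U\<in>F. |U| \<le>o |V| ) \<and>
     (\<forall>W::'b set. (\<forall>U\<in>F. |U| \<le>o |W| ) \<longrightarrow> |V| \<le>o |W| )|"

lemma card_sup_aux:
  fixes F :: "'b set set"
  shows "\<exists>V. card_sup F = |V| \<and> (\<forall>U\<in>F. |U| \<le>o |V| ) \<and>
     (\<forall>W::'b set. (\<forall>U\<in>F. |U| \<le>o |W| ) \<longrightarrow> |V| \<le>o |W| )"
proof -
  let ?Q = "\<lambda>V::'b set. \<forall>U\<in>F. |U| \<le>o |V|"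
  let ?R = "card_of ` {V. ?Q V}"
  have "|UNIV :: 'b set| \<in> ?R" by (auto intro: card_of_mono1)
  then have "?R \<noteq> {}" by blast
  moreover have "\<forall>r\<in>?R. Well_order r" using card_of_Well_order by blast
  ultimately obtain r where "r \<in> ?R" "\<forall>r'\<in>?R. r \<le>o r'"
    using exists_minim_Well_order[of ?R] by blast
  then have "\<exists>V. ?Q V \<and> (\<forall>W. ?Q W \<longrightarrow> |V| \<le>o |W| )" by blast
  from someI_ex[OF this] show ?thesis unfolding card_sup_def by blast
qed

lemma card_sup_upper: "U \<in> F \<Longrightarrow> |U| \<le>o card_sup F"
  using card_sup_aux[of F] by auto

lemma card_sup_least:
  fixes F :: "'b set set" and C :: "'c set"
  assumes "\<And>U. U \<in> F \<Longrightarrow> |U| \<le>o |C|"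
  shows "card_sup F \<le>o |C|"
proof -
  from card_sup_aux[of F] obtain V where V: "card_sup F = |V|"
      "\<forall>W::'b set. (\<forall>U\<in>F. |U| \<le>o |W| ) \<longrightarrow> |V| \<le>o |W|"
    by (elim exE conjE)
  consider "|V| \<le>o |C|" | "|C| \<le>o |V|"
    using ordLeq_total[OF card_of_Well_order card_of_Well_order] by blast
  then show ?thesis
  proof cases
    case 1
    then show ?thesis by (simp only: V(1))
  next
    case 2
    from iffD2[OF card_of_ordLeq 2] obtain f where f: "inj_on f C" "f ` C \<subseteq> V"
      by (elim exE conjE)
    have iso: "|C| =o |f ` C|" by (rule card_of_ordIsoI[OF inj_on_imp_bij_betw[OF f(1)]])
    have "\<forall>U\<in>F. |U| \<le>o |f ` C|"
      by (intro ballI ordLeq_ordIso_trans[OF assms iso])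
    then have "|V| \<le>o |f ` C|" by (rule mp[OF spec[OF V(2)]])
    then show ?thesis
      unfolding V(1) by (rule ordLeq_ordIso_trans[OF _ ordIso_symmetric[OF iso]])
  qed
qed

text \<open>The ambient space is the whole type; families are unindexed sets of open sets.\<close>

definition c_pb :: "'a::topological_space set \<Rightarrow> 'a set rel" where
  "c_pb A = card_sup {\<U>. nonempty_open_family \<U> \<and> point_bounded \<U> \<and> meeting \<U> A}"

definition c_pf :: "'a::topological_space set \<Rightarrow> 'a set rel" where
  "c_pf A = card_sup {\<U>. nonempty_open_family \<U> \<and> point_finite \<U> \<and> meeting \<U> A}"


section \<open>Banach space notions\<close>

text \<open>An isomorphic embedding defined on a linear subspace \<open>V\<close> of a normed space.\<close>

definition isomorphic_embedding_on ::
    "'a::real_normed_vector set \<Rightarrow> ('a \<Rightarrow> 'b::real_normed_vector) \<Rightarrow> bool" where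
  "isomorphic_embedding_on V T \<longleftrightarrow>
     (\<forall>x\<in>V. \<forall>y\<in>V. T (x + y) = T x + T y) \<and>
     (\<forall>c. \<forall>x\<in>V. T (c *\<^sub>R x) = c *\<^sub>R T x) \<and>
     (\<exists>B. \<forall>x\<in>V. norm (T x) \<le> B * norm x) \<and>
     inj_on T V \<and>
     (\<exists>B. \<forall>y\<in>T ` V. norm (inv_into V T y) \<le> B * norm y)"

lemma isomorphic_embedding_on_UNIV:
  "isomorphic_embedding_on UNIV T \<longleftrightarrow>
     bounded_linear T \<and> inj T \<and> (\<exists>B. \<forall>y\<in>range T. norm (inv T y) \<le> B * norm y)"
  unfolding isomorphic_embedding_on_def bounded_linear_def bounded_linear_axioms_def linear_iff
  by (auto simp: mult.commute)

text \<open>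
  The norm of an operator defined on a subspace \<open>V\<close> only; for \<open>V = UNIV\<close> it is \<^const>\<open>onorm\<close>. The
  vector \<open>0\<close> contributes \<open>0 / 0 = 0\<close>.
\<close>

definition onorm_on :: "'a::real_normed_vector set \<Rightarrow> ('a \<Rightarrow> 'b::real_normed_vector) \<Rightarrow> real" where
  "onorm_on V f = (SUP x\<in>V. norm (f x) / norm x)"

text \<open>
  \<open>c\<^sub>0\<close> as a subspace of \<open>\<ell>\<^sub>\<infinity>\<close>, which is \<open>nat \<Rightarrow>\<^sub>C real\<close> since \<open>nat\<close> carries the discrete topology.
\<close>

definition c0 :: "(nat \<Rightarrow>\<^sub>C real) set" where
  "c0 = {f. apply_bcontfun f \<longlonglongrightarrow> 0}"

definition contains_copy_of_c0 :: "'e::real_normed_vector itself \<Rightarrow> bool" where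
  "contains_copy_of_c0 _ \<longleftrightarrow> (\<exists>S :: (nat \<Rightarrow>\<^sub>C real) \<Rightarrow> 'e. isomorphic_embedding_on c0 S)"

definition rademacher :: "nat \<Rightarrow> real \<Rightarrow> real" where
  "rademacher i t = sgn (sin (2 ^ i * pi * t))"

definition nontrivial_cotype :: "'e::real_normed_vector itself \<Rightarrow> bool" where
  "nontrivial_cotype _ \<longleftrightarrow>
     (\<exists>q\<ge>(2::real). \<exists>C>(0::real). \<forall>n\<ge>(1::nat). \<forall>e :: nat \<Rightarrow> 'e.
        (\<Sum>i=1..n. norm (e i) powr q) powr (1 / q)
        \<le> C * sqrt (integral {0..1} (\<lambda>t. (norm (\<Sum>i=1..n. rademacher i t *\<^sub>R e i))\<^sup>2)))"

end

theory Submission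
  imports Defs "HOL-Library.Multiset"
begin

text \<open>
  Write \<open>D\<close> for the derivative of order \<open>\<omega>\<^sup>\<alpha>\<close>, fix \<open>\<epsilon> > 0\<close>, and call \<open>f\<close> large at \<open>y\<close> if
  \<open>\<parallel>T f y\<parallel> \<ge> \<epsilon>\<close>. If every bump function \<open>f\<close> supported in an open set \<open>U\<close> meeting \<open>D\<^sup>n K\<^sub>1\<close> is
  large nowhere on \<open>D\<^sup>k K\<^sub>2\<close>, one finds nested bump functions \<open>g\<^sub>0 \<ge> \<dots> \<ge> g\<^sub>n\<close> in \<open>U\<close>, each equal to 1
  where the next one does not vanish, of which at most \<open>k\<close> are large at any given point. Then
  \<open>u = g\<^sub>0 + \<dots> + g\<^bsub>k-1\<^esub> + 2 (g\<^sub>k + \<dots> + g\<^sub>n)\<close> has norm \<open>2n + 2 - k\<close>, while for each \<open>y\<close> the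
  coefficients of the functions that are not large at \<open>y\<close> can be changed so that the norm drops to
  at most \<open>k\<close>, which hardly affects \<open>T u y\<close>; this gives the bound \<open>(2n + 2 - k) / k\<close>. The
  combination \<open>g\<^sub>0 + 2 g\<^sub>n\<close> of norm 3, from which \<open>2 g\<^sub>i\<close> is subtracted for some \<open>g\<^sub>i\<close> not large
  at \<open>y\<close>, gives the bound 3 in the same way.

  If the bound fails, then every member \<open>U\<close> of a point-bounded family meeting \<open>D\<^sup>n K\<^sub>1\<close> therefore
  carries a bump function \<open>f\<^sub>U\<close> that is large somewhere on \<open>D\<^sup>k K\<^sub>2\<close>. The sets where
  \<open>\<parallel>T f\<^sub>U y\<parallel> > \<epsilon>/2\<close> form a point-finite family, and under cotype even a point-bounded one, because the
  signed sums of the vectors \<open>T f\<^sub>U y\<close> are bounded; this contradicts the hypothesis on cardinals.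

  The nested functions come from an induction on \<open>\<alpha>\<close>: a closed set \<open>L\<close> with \<open>D L = \<emptyset>\<close> admits a bump
  function near any point of \<open>D A\<close> that is equal to 1 near a point of \<open>A\<close> and large nowhere on \<open>L\<close>,
  namely an average of nested functions obtained for a smaller exponent.
\<close>

section \<open>Well-orders\<close>

lemma Well_orderI:
  assumes "\<And>x. x \<in> Field r \<Longrightarrow> (x, x) \<in> r" and "trans r" and "antisym r"
    and "\<And>x y. x \<in> Field r \<Longrightarrow> y \<in> Field r \<Longrightarrow> x \<noteq> y \<Longrightarrow> (x, y) \<in> r \<or> (y, x) \<in> r"
    and "wf (r - Id)"
  shows "Well_order r"
  unfolding order_on_defs refl_on_def total_on_def using assms by (auto simp: FieldI1 FieldI2)

lemma Well_order_refl: "Well_order r \<Longrightarrow> x \<in> Field r \<Longrightarrow> (x, x) \<in> r"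
  unfolding order_on_defs refl_on_def by blast

lemma Well_order_trans: "Well_order r \<Longrightarrow> (x, y) \<in> r \<Longrightarrow> (y, z) \<in> r \<Longrightarrow> (x, z) \<in> r"
  unfolding order_on_defs trans_def by blast

lemma Well_order_antisym: "Well_order r \<Longrightarrow> (x, y) \<in> r \<Longrightarrow> (y, x) \<in> r \<Longrightarrow> x = y"
  unfolding order_on_defs antisym_def by blast

lemma Well_order_total:
  "Well_order r \<Longrightarrow> x \<in> Field r \<Longrightarrow> y \<in> Field r \<Longrightarrow> (x, y) \<in> r \<or> (y, x) \<in> r"
  by (cases "x = y") (auto simp: order_on_defs total_on_def dest: refl_onD)

lemma Well_order_wf: "Well_order r \<Longrightarrow> wf (r - Id)"
  unfolding order_on_defs by blast

lemma Well_order_finite_max: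
  assumes "Well_order r" "finite A" "A \<noteq> {}" "A \<subseteq> Field r"
  shows "\<exists>m\<in>A. \<forall>a\<in>A. (a, m) \<in> r"
  using assms(2-)
proof (induction rule: finite_ne_induct)
  case (singleton x)
  then show ?case using Well_order_refl[OF assms(1)] by auto
next
  case (insert x F)
  then obtain m where m: "m \<in> F" "\<forall>a\<in>F. (a, m) \<in> r" by auto
  have "(x, m) \<in> r \<or> (m, x) \<in> r" using Well_order_total[OF assms(1)] insert m(1) by auto
  then show ?case
    using m Well_order_trans[OF assms(1)] Well_order_refl[OF assms(1)] insert.prems by blast
qed

lemma Field_ord_prod:
  assumes "Well_order r" "Well_order s"
  shows "Field (ord_prod r s) = Field r \<times> Field s"
proof
  show "Field (ord_prod r s) \<subseteq> Field r \<times> Field s" by (auto simp: Field_def ord_prod_def)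
  show "Field r \<times> Field s \<subseteq> Field (ord_prod r s)"
  proof clarify
    fix x i assume "x \<in> Field r" "i \<in> Field s"
    then have "((x, i), (x, i)) \<in> ord_prod r s"
      using Well_order_refl[OF assms(1)] by (auto simp: ord_prod_def)
    then show "(x, i) \<in> Field (ord_prod r s)" by (rule FieldI1)
  qed
qed

lemma Well_order_ord_prod:
  assumes r: "Well_order r" and s: "Well_order s"
  shows "Well_order (ord_prod r s)"
proof (rule Well_orderI)
  note F = Field_ord_prod[OF r s]
  show "(p, p) \<in> ord_prod r s" if "p \<in> Field (ord_prod r s)" for p
    using that Well_order_refl[OF r] unfolding F by (cases p) (auto simp: ord_prod_def)
  show "trans (ord_prod r s)"
  proof (rule transI)
    fix p q t assume "(p, q) \<in> ord_prod r s" "(q, t) \<in> ord_prod r s"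
    then show "(p, t) \<in> ord_prod r s"
      using Well_order_trans[OF r, of "fst p" "fst q" "fst t"]
        Well_order_trans[OF s, of "snd p" "snd q" "snd t"] Well_order_antisym[OF s, of "snd p" "snd q"]
      by (auto simp: ord_prod_def)
  qed
  show "antisym (ord_prod r s)"
    unfolding antisym_def ord_prod_def
    using Well_order_antisym[OF r] Well_order_antisym[OF s] by auto
  show "(p, q) \<in> ord_prod r s \<or> (q, p) \<in> ord_prod r s"
    if "p \<in> Field (ord_prod r s)" "q \<in> Field (ord_prod r s)" for p q
    using that Well_order_total[OF r, of "fst p" "fst q"] Well_order_total[OF s, of "snd p" "snd q"]
    unfolding F by (auto simp: ord_prod_def)
  \<comment> \<open>The second coordinate decides first, so the strict order is lexicographic after
    swapping the coordinates.\<close>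
  have "ord_prod r s - Id \<subseteq> inv_image ((s - Id) <*lex*> (r - Id)) prod.swap"
    unfolding ord_prod_def by (auto simp: in_inv_image)
  then show "wf (ord_prod r s - Id)"
    by (rule wf_subset[rotated]) (intro wf_inv_image wf_lex_prod Well_order_wf r s)
qed

lemma Field_omega_power: "Field (omega_power r) = fin_supp_funs r"
  unfolding Field_def omega_power_def by auto

text \<open>Well-foundedness comes from the multiset order: a finitely supported function counts the
  elements of a finite multiset, and every element that the smaller function has in excess lies
  below the deciding argument, which the larger one has in excess.\<close>

lemma Well_order_omega_power:
  assumes r: "Well_order r"
  shows "Well_order (omega_power r)"
proof (rule Well_orderI)
  show "(f, f) \<in> omega_power r" if "f \<in> Field (omega_power r)" for f
    using that unfolding Field_omega_power by (auto simp: omega_power_def)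
  have less_trans: "\<exists>a\<in>Field r. f a < h a \<and> (\<forall>b. (a, b) \<in> r \<and> b \<noteq> a \<longrightarrow> f b = h b)"
    if a: "a \<in> Field r" "f a < g a" "\<forall>b. (a, b) \<in> r \<and> b \<noteq> a \<longrightarrow> f b = g b"
      and a': "a' \<in> Field r" "g a' < h a'" "\<forall>b. (a', b) \<in> r \<and> b \<noteq> a' \<longrightarrow> g b = h b"
    for f g h :: "'a \<Rightarrow> nat" and a a'
  proof -
    consider "a = a'" | "a \<noteq> a'" "(a, a') \<in> r" | "a \<noteq> a'" "(a', a) \<in> r"
      using Well_order_total[OF r a(1) a'(1)] by blast
    then show ?thesis
    proof cases
      case 1
      have "f a < h a" "\<forall>b. (a, b) \<in> r \<and> b \<noteq> a \<longrightarrow> f b = h b" using 1 a a' by auto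
      then show ?thesis using a(1) by blast
    next
      case 2
      have "f a' < h a'" using a(3) a'(2) 2 by auto
      moreover have "f b = h b" if "(a', b) \<in> r" "b \<noteq> a'" for b
      proof -
        have "b \<noteq> a" using that Well_order_antisym[OF r 2(2)] by auto
        then show ?thesis using a(3) a'(3) that Well_order_trans[OF r 2(2) that(1)] by simp
      qed
      ultimately show ?thesis using a'(1) by blast
    next
      case 3
      have "f a < h a" using a'(3) a(2) 3 by auto
      moreover have "f b = h b" if "(a, b) \<in> r" "b \<noteq> a" for b
      proof -
        have "b \<noteq> a'" using that Well_order_antisym[OF r 3(2)] by auto
        then show ?thesis using a(3) a'(3) that Well_order_trans[OF r 3(2) that(1)] by simp
      qed
      ultimately show ?thesis using a(1) by blast
    qed
  qed
  show "trans (omega_power r)"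
  proof (rule transI)
    fix f g h assume fg: "(f, g) \<in> omega_power r" and gh: "(g, h) \<in> omega_power r"
    show "(f, h) \<in> omega_power r"
    proof (cases "f = g \<or> g = h")
      case True
      then show ?thesis using fg gh by auto
    next
      case False
      then obtain a a' where
        "a \<in> Field r" "f a < g a" "\<forall>b. (a, b) \<in> r \<and> b \<noteq> a \<longrightarrow> f b = g b"
        "a' \<in> Field r" "g a' < h a'" "\<forall>b. (a', b) \<in> r \<and> b \<noteq> a' \<longrightarrow> g b = h b"
        using fg gh unfolding omega_power_def by blast
      from less_trans[OF this] show ?thesis
        using fg gh unfolding omega_power_def by blast
    qed
  qed
  have less_wf: "wf {(f, g). f \<in> fin_supp_funs r \<and> g \<in> fin_supp_funs r \<and>
     (\<exists>a\<in>Field r. f a < g a \<and> (\<forall>b. (a, b) \<in> r \<and> b \<noteq> a \<longrightarrow> f b = g b))}" (is "wf ?L")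
  proof (rule wf_subset)
    show "wf (inv_image (mult (r - Id)) Abs_multiset)"
      by (intro wf_inv_image wf_mult Well_order_wf r)
    show "?L \<subseteq> inv_image (mult (r - Id)) Abs_multiset"
    proof clarify
      fix f g a
      assume f: "f \<in> fin_supp_funs r" and g: "g \<in> fin_supp_funs r"
        and a: "a \<in> Field r" "f a < g a" "\<forall>b. (a, b) \<in> r \<and> b \<noteq> a \<longrightarrow> f b = g b"
      have cf: "count (Abs_multiset f) = f" and cg: "count (Abs_multiset g) = g"
        using f g by (auto simp: fin_supp_funs_def Abs_multiset_inverse)
      let ?F = "Abs_multiset f" and ?G = "Abs_multiset g"
      \<comment> \<open>The common part stays, and the nonempty \<open>?G - ?F\<close> is replaced
        by \<open>?F - ?G\<close>, whose elements all lie below \<open>a\<close>.\<close>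
      have "(?F \<inter># ?G + (?F - ?G), ?F \<inter># ?G + (?G - ?F)) \<in> mult (r - Id)"
      proof (rule one_step_implies_mult)
        have in_J: "a \<in># ?G - ?F" using a by (simp add: in_diff_count cf cg)
        then show "?G - ?F \<noteq> {#}" by auto
        show "\<forall>k\<in>set_mset (?F - ?G). \<exists>j\<in>set_mset (?G - ?F). (k, j) \<in> r - Id"
        proof
          fix k assume "k \<in># ?F - ?G"
          then have k: "g k < f k" by (simp add: in_diff_count cf cg)
          then have "k \<in> Field r" using f by (auto simp: fin_supp_funs_def)
          moreover have "k \<noteq> a" using k a(2) by auto
          ultimately have "(k, a) \<in> r - Id"
            using Well_order_total[OF r _ a(1), of k] a(3) k by auto
          then show "\<exists>j\<in>set_mset (?G - ?F). (k, j) \<in> r - Id" using in_J by blast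
        qed
      qed
      moreover have "?F \<inter># ?G + (?F - ?G) = ?F" "?F \<inter># ?G + (?G - ?F) = ?G"
        by (auto intro!: multiset_eqI simp: cf cg)
      ultimately show "(f, g) \<in> inv_image (mult (r - Id)) Abs_multiset" by simp
    qed
  qed
  show "wf (omega_power r - Id)"
    by (rule wf_subset[OF less_wf]) (auto simp: omega_power_def)
  show "antisym (omega_power r)"
    unfolding antisym_def omega_power_def using wf_not_sym[OF less_wf] by auto
  show "(f, g) \<in> omega_power r \<or> (g, f) \<in> omega_power r"
    if "f \<in> Field (omega_power r)" "g \<in> Field (omega_power r)" "f \<noteq> g" for f g
  proof -
    have fg: "f \<in> fin_supp_funs r" "g \<in> fin_supp_funs r"
      using that unfolding Field_omega_power by auto
    let ?A = "{a. f a \<noteq> g a}"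
    have "?A \<subseteq> {a. f a \<noteq> 0} \<union> {a. g a \<noteq> 0}" by auto
    then have "finite ?A" "?A \<subseteq> Field r"
      using fg unfolding fin_supp_funs_def by (auto dest: finite_subset)
    moreover have "?A \<noteq> {}" using that(3) by auto
    ultimately obtain m where m: "m \<in> ?A" "\<forall>a\<in>?A. (a, m) \<in> r"
      using Well_order_finite_max[OF r] by blast
    then have "\<forall>b. (m, b) \<in> r \<and> b \<noteq> m \<longrightarrow> f b = g b"
      using Well_order_antisym[OF r] by blast
    moreover have "m \<in> Field r" using m \<open>?A \<subseteq> Field r\<close> by blast
    moreover have "f m < g m \<or> g m < f m" using m by auto
    ultimately show ?thesis using fg unfolding omega_power_def by auto
  qed
qed

section \<open>Derivatives of order \<open>\<omega>\<^sup>\<alpha> k\<close>\<close>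

text \<open>
  If \<open>S\<close> is the set of ordinals below \<open>\<gamma>\<close> and \<open>F c\<close> is the derivative of order \<open>\<omega>\<^sup>c\<close> for \<open>c \<in> S\<close>, then
  \<open>omega_step F S\<close> is the derivative of order \<open>\<omega>\<^sup>\<gamma>\<close>, the supremum of the \<open>\<omega>\<^sup>c m\<close> unless \<open>\<gamma> = 0\<close>.
\<close>

definition omega_step :: "('o \<Rightarrow> 'a set \<Rightarrow> 'a set) \<Rightarrow> 'o set \<Rightarrow> 'a::topological_space set \<Rightarrow> 'a set" where
  "omega_step F S A = (if S = {} then accum_points A else \<Inter>c\<in>S. \<Inter>m. (F c ^^ m) A)"

text \<open>The recursion runs on the exponent and involves no ordinal sums or products;
  \<open>cb_deriv_w\<close> links it to \<open>cb_deriv\<close>.\<close>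

definition omega_deriv :: "'o rel \<Rightarrow> 'o \<Rightarrow> 'a::topological_space set \<Rightarrow> 'a set" where
  "omega_deriv r = wo_rel.worec r (\<lambda>F a. omega_step F (underS r a))"

lemma omega_deriv_unfold:
  assumes "Well_order r"
  shows "omega_deriv r a = omega_step (omega_deriv r) (underS r a)"
proof -
  have wo: "wo_rel r" by (rule wo_rel.intro[OF assms])
  have "wo_rel.adm_wo r (\<lambda>F a. omega_step F (underS r a) :: 'b set \<Rightarrow> 'b set)"
    unfolding wo_rel.adm_wo_def[OF wo] omega_step_def
    by (intro allI impI ext if_cong refl INF_cong) simp
  from fun_cong[OF wo_rel.worec_fixpoint[OF wo this], of a] show ?thesis
    unfolding omega_deriv_def .
qed

lemma accum_points_subset: "accum_points A \<subseteq> A"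
  by (auto simp: accum_points_def)

lemma cb_step_max:
  assumes "Well_order w" "m \<in> S" "\<forall>c\<in>S. (c, m) \<in> w"
  shows "cb_step w X D S = accum_points (D m)"
proof -
  have "(THE m. m \<in> S \<and> (\<forall>c\<in>S. (c, m) \<in> w)) = m"
    using assms Well_order_antisym[OF assms(1)] by (intro the_equality) auto
  then show ?thesis using assms unfolding cb_step_def by auto
qed

lemma cb_step_limit:
  assumes "S \<noteq> {}" "\<And>m. m \<in> S \<Longrightarrow> \<exists>c\<in>S. (c, m) \<notin> w"
  shows "cb_step w X D S = (\<Inter>c\<in>S. D c)"
  using assms unfolding cb_step_def by auto

lemma cb_deriv_at_antimono:
  assumes w: "Well_order w" and "(p, q) \<in> w"
  shows "cb_deriv_at w X q \<subseteq> cb_deriv_at w X p"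
proof -
  have "\<forall>p. (p, q) \<in> w \<longrightarrow> cb_deriv_at w X q \<subseteq> cb_deriv_at w X p"
  proof (rule wo_rel.well_order_induct[OF wo_rel.intro[OF w], of _ q], intro allI impI)
    fix q p assume IH: "\<forall>y. y \<noteq> q \<and> (y, q) \<in> w \<longrightarrow> (\<forall>p. (p, y) \<in> w \<longrightarrow> cb_deriv_at w X y \<subseteq> cb_deriv_at w X p)"
      and pq: "(p, q) \<in> w"
    show "cb_deriv_at w X q \<subseteq> cb_deriv_at w X p"
    proof (cases "p = q")
      case False
      then have p: "p \<in> underS w q" using pq by (auto simp: underS_def)
      show ?thesis
      proof (cases "\<exists>m\<in>underS w q. \<forall>c\<in>underS w q. (c, m) \<in> w")
        case True
        then obtain m where m: "m \<in> underS w q" "\<forall>c\<in>underS w q. (c, m) \<in> w" by blast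
        then have "cb_deriv_at w X q = accum_points (cb_deriv_at w X m)"
          unfolding cb_deriv_at_unfold[OF w, of X q] by (rule cb_step_max[OF w])
        also have "\<dots> \<subseteq> cb_deriv_at w X m" by (rule accum_points_subset)
        also have "\<dots> \<subseteq> cb_deriv_at w X p" using IH m p by (auto simp: underS_def)
        finally show ?thesis .
      next
        case False
        then have "cb_deriv_at w X q = (\<Inter>c\<in>underS w q. cb_deriv_at w X c)"
          unfolding cb_deriv_at_unfold[OF w, of X q] using p by (intro cb_step_limit) auto
        then show ?thesis using p by blast
      qed
    qed simp
  qed
  then show ?thesis using assms(2) by blast
qed

text \<open>The last hypothesis keeps \<open>S\<close> from having a largest element, so the limit
  clause applies, and by \<open>cb_deriv_at_antimono\<close> the intersection may be restricted to
  the cofinal set \<open>C\<close>.\<close>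

lemma cb_step_cofinal:
  assumes w: "Well_order w" and "C \<noteq> {}" "C \<subseteq> S" "\<And>q. q \<in> S \<Longrightarrow> \<exists>p\<in>C. (q, p) \<in> w"
    and "\<And>p. p \<in> C \<Longrightarrow> \<exists>p'\<in>S. (p', p) \<notin> w"
  shows "cb_step w X (cb_deriv_at w X) S = (\<Inter>p\<in>C. cb_deriv_at w X p)"
proof -
  have "cb_step w X (cb_deriv_at w X) S = (\<Inter>p\<in>S. cb_deriv_at w X p)"
  proof (rule cb_step_limit)
    show "S \<noteq> {}" using assms by blast
    fix m assume "m \<in> S"
    then obtain p where p: "p \<in> C" "(m, p) \<in> w" using assms by blast
    then obtain p' where "p' \<in> S" "(p', p) \<notin> w" using assms(5) by blast
    then show "\<exists>c\<in>S. (c, m) \<notin> w" using p Well_order_trans[OF w] by blast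
  qed
  also have "\<dots> = (\<Inter>p\<in>C. cb_deriv_at w X p)"
    using assms(3,4) cb_deriv_at_antimono[OF w, of _ _ X] by fast
  finally show ?thesis .
qed

section \<open>Cofinal sequences in powers of \<omega>\<close>

lemma fin_supp_funs_outside: "f \<in> fin_supp_funs r \<Longrightarrow> b \<notin> Field r \<Longrightarrow> f b = 0"
  unfolding fin_supp_funs_def by blast

lemma fin_supp_funs_update:
  "f \<in> fin_supp_funs r \<Longrightarrow> c \<in> Field r \<Longrightarrow> f(c := m) \<in> fin_supp_funs r"
  unfolding fin_supp_funs_def
  by (auto intro: finite_subset[of _ "insert c {a. f a \<noteq> 0}"])

text \<open>If \<open>g\<close> is not below \<open>f\<close>, the two differ only on
  \<open>C\<close>, where \<open>f\<close> vanishes. At the largest \<open>c\<close> in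
  \<open>C\<close> with \<open>g c\<close> nonzero, the value \<open>Suc (g c)\<close> lifts
  \<open>f\<close> above \<open>g\<close>, since both agree beyond \<open>c\<close>.\<close>

lemma omega_power_cofinal:
  assumes r: "Well_order r" and f: "f \<in> fin_supp_funs r" and g: "g \<in> fin_supp_funs r"
    and C: "C \<subseteq> Field r" "C \<noteq> {}" "\<And>c. c \<in> C \<Longrightarrow> f c = 0"
    and gf: "(g, f) \<in> omega_power r \<or> (\<forall>b. b \<notin> C \<longrightarrow> g b = f b)"
  shows "\<exists>c\<in>C. \<exists>m. (g, f(c := m)) \<in> omega_power r"
proof (cases "(g, f) \<in> omega_power r")
  case True
  obtain c where c: "c \<in> C" using C(2) by blast
  then have "f(c := 0) = f" using C(3) by auto
  then show ?thesis using True c by metis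
next
  case False
  then have eq: "\<And>b. b \<notin> C \<Longrightarrow> g b = f b" using gf by blast
  let ?A = "{c \<in> C. g c \<noteq> 0}"
  have "finite ?A" using g unfolding fin_supp_funs_def by (auto intro: finite_subset)
  moreover have "?A \<noteq> {}"
  proof
    assume "?A = {}"
    then have "g = f" using eq C(3) by (intro ext) (metis (mono_tags, lifting) empty_iff mem_Collect_eq)
    then show False using False f by (auto simp: omega_power_def)
  qed
  ultimately obtain c where c: "c \<in> ?A" "\<forall>a\<in>?A. (a, c) \<in> r"
    using Well_order_finite_max[OF r, of ?A] C(1) by auto
  have "g b = (f(c := Suc (g c))) b" if "(c, b) \<in> r" "b \<noteq> c" for b
  proof (cases "b \<in> C")
    case True
    then have "g b = 0" using c(2) that Well_order_antisym[OF r] by blast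
    then show ?thesis using True C(3) that by simp
  next
    case False
    then show ?thesis using eq that by simp
  qed
  moreover have "c \<in> Field r" using c C by blast
  ultimately have "(g, f(c := Suc (g c))) \<in> omega_power r"
    unfolding omega_power_def using g fin_supp_funs_update[OF f]
    by (auto intro!: bexI[of _ c])
  then show ?thesis using c by blast
qed

context
  fixes r :: "'o rel" and k :: nat and w :: "(('o \<Rightarrow> nat) \<times> nat) rel" and X :: "'a::topological_space set"
  assumes r: "Well_order r" defines "w \<equiv> omega_power_times r k"
begin

lemma Well_order_w: "Well_order w"
  unfolding w_def by (intro Well_order_ord_prod Well_order_omega_power r natLeq_on_Well_order)

lemma Field_w: "Field w = fin_supp_funs r \<times> {..<k}"
  unfolding w_def Field_ord_prod[OF Well_order_omega_power[OF r] natLeq_on_Well_order]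
    Field_omega_power Field_natLeq_on by auto

lemma w_iff:
  "((f, i), (g, j)) \<in> w \<longleftrightarrow> f \<in> fin_supp_funs r \<and> g \<in> fin_supp_funs r \<and> i < k \<and> j < k \<and>
     (i < j \<or> i = j \<and> (f, g) \<in> omega_power r)"
  unfolding w_def ord_prod_def
  by (auto simp: Field_omega_power Field_natLeq_on)

lemma omega_power_less_update:
  assumes "f \<in> fin_supp_funs r" "c \<in> Field r" "m < m'"
  shows "(f(c := m), f(c := m')) \<in> omega_power r" "(f(c := m'), f(c := m)) \<notin> omega_power r"
proof -
  show *: "(f(c := m), f(c := m')) \<in> omega_power r"
    unfolding omega_power_def using assms fin_supp_funs_update by (auto intro!: bexI[of _ c])
  show "(f(c := m'), f(c := m)) \<notin> omega_power r"
  proof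
    assume "(f(c := m'), f(c := m)) \<in> omega_power r"
    from Well_order_antisym[OF Well_order_omega_power[OF r] * this] have "m = m'"
      by (metis fun_upd_same)
    then show False using assms by simp
  qed
qed

text \<open>One block of length \<open>\<omega>\<^sup>a\<close>, where \<open>C\<close> stands for the ordinals below \<open>a\<close> and \<open>S\<close> for the
  ordinals below the end of the block that starts at \<open>(f, i)\<close>.\<close>

lemma cb_step_block:
  assumes f: "f \<in> fin_supp_funs r" and i: "i < k"
    and C: "C \<subseteq> Field r" "\<And>c. c \<in> C \<Longrightarrow> f c = 0"
    and S: "(f, i) \<in> S" "\<And>c m. c \<in> C \<Longrightarrow> (f(c := m), i) \<in> S"
    and cof: "\<And>q. q \<in> S \<Longrightarrow> if C = {} then (q, (f, i)) \<in> w else \<exists>c\<in>C. \<exists>m. (q, (f(c := m), i)) \<in> w"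
    and iter: "\<And>c m. c \<in> C \<Longrightarrow>
      cb_deriv_at w X (f(c := m), i) = (omega_deriv r c ^^ m) (cb_deriv_at w X (f, i))"
  shows "cb_step w X (cb_deriv_at w X) S = omega_step (omega_deriv r) C (cb_deriv_at w X (f, i))"
proof (cases "C = {}")
  case True
  then show ?thesis using cb_step_max[OF Well_order_w S(1)] cof by (simp add: omega_step_def)
next
  case False
  let ?C = "(\<lambda>(c, m). (f(c := m), i)) ` (C \<times> UNIV)"
  have "cb_step w X (cb_deriv_at w X) S = (\<Inter>p\<in>?C. cb_deriv_at w X p)"
  proof (rule cb_step_cofinal[OF Well_order_w])
    show "?C \<noteq> {}" using False by auto
    show "?C \<subseteq> S" using S by auto
    show "\<exists>p\<in>?C. (q, p) \<in> w" if "q \<in> S" for q using cof[OF that] False by auto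
    fix p assume "p \<in> ?C"
    then obtain c m where p: "p = (f(c := m), i)" "c \<in> C" by auto
    moreover have "((f(c := Suc m), i), p) \<notin> w"
      unfolding p w_iff using omega_power_less_update[OF f, of c m "Suc m"] C p by auto
    ultimately show "\<exists>p'\<in>S. (p', p) \<notin> w" using S(2) by blast
  qed
  also have "\<dots> = (\<Inter>c\<in>C. \<Inter>m. cb_deriv_at w X (f(c := m), i))" by auto
  also have "\<dots> = (\<Inter>c\<in>C. \<Inter>m. (omega_deriv r c ^^ m) (cb_deriv_at w X (f, i)))"
    using iter by auto
  finally show ?thesis using False by (simp add: omega_step_def)
qed

text \<open>\<open>shift\<close> is a hypothesis because the lemma serves twice: inside the
  induction for \<open>cb_deriv_at_shift\<close>, where only exponents below the current one are
  available, and afterwards for all exponents.\<close>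

lemma cb_deriv_at_iterate:
  assumes shift: "\<And>f. f \<in> fin_supp_funs r \<Longrightarrow> \<forall>b\<in>underS r c. f b = 0 \<Longrightarrow>
      cb_deriv_at w X (f(c := Suc (f c)), i) = omega_deriv r c (cb_deriv_at w X (f, i))"
    and f: "f \<in> fin_supp_funs r" "\<forall>b\<in>underS r c. f b = 0" "f c = 0" and c: "c \<in> Field r"
  shows "cb_deriv_at w X (f(c := m), i) = (omega_deriv r c ^^ m) (cb_deriv_at w X (f, i))"
proof (induction m)
  case 0
  have "f(c := 0) = f" using f(3) by auto
  then show ?case by simp
next
  case (Suc m)
  have "\<forall>b\<in>underS r c. (f(c := m)) b = 0" using f(2) by (auto simp: underS_def)
  from shift[OF fin_supp_funs_update[OF f(1) c] this] Suc show ?case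
    by (simp add: fun_upd_same del: fun_upd_apply)
qed

text \<open>Induction on \<open>a\<close>: the positions \<open>f(c := m)\<close> with
  \<open>c\<close> below \<open>a\<close> are cofinal below the new position, or \<open>f\<close>
  itself is the largest one if \<open>a\<close> is least, and the induction hypothesis evaluates the
  derivatives there. In ordinal terms, \<open>\<omega>\<^sup>a\<close> is added to an ordinal whose
  normal form has no exponent below \<open>a\<close>.\<close>

lemma cb_deriv_at_shift:
  assumes f: "f \<in> fin_supp_funs r" and i: "i < k" and a: "a \<in> Field r" and "\<forall>b\<in>underS r a. f b = 0"
  shows "cb_deriv_at w X (f(a := Suc (f a)), i) = omega_deriv r a (cb_deriv_at w X (f, i))"
proof -
  have "a \<in> Field r \<longrightarrow> (\<forall>f. f \<in> fin_supp_funs r \<longrightarrow> (\<forall>b\<in>underS r a. f b = 0) \<longrightarrow>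
    cb_deriv_at w X (f(a := Suc (f a)), i) = omega_deriv r a (cb_deriv_at w X (f, i)))"
  proof (rule wo_rel.well_order_induct[OF wo_rel.intro[OF r], of _ a], intro allI impI)
    fix a f
    assume IH: "\<forall>y. y \<noteq> a \<and> (y, a) \<in> r \<longrightarrow> (y \<in> Field r \<longrightarrow> (\<forall>f. f \<in> fin_supp_funs r \<longrightarrow> (\<forall>b\<in>underS r y. f b = 0) \<longrightarrow>
        cb_deriv_at w X (f(y := Suc (f y)), i) = omega_deriv r y (cb_deriv_at w X (f, i))))"
      and a: "a \<in> Field r" and f: "f \<in> fin_supp_funs r" and f0: "\<forall>b\<in>underS r a. f b = 0"
    let ?f' = "f(a := Suc (f a))" and ?C = "underS r a"
    have C: "?C \<subseteq> Field r" by (auto simp: underS_def Field_def)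
    have f': "?f' \<in> fin_supp_funs r" using fin_supp_funs_update[OF f a] .
    have below: "(f(c := m), i) \<in> underS w (?f', i)" if "c = a \<and> m = f a \<or> c \<in> ?C" for c m
    proof -
      have cF: "c \<in> Field r" using that a C by auto
      have "(f(c := m), ?f') \<in> omega_power r \<and> f(c := m) \<noteq> ?f'"
        using that f f' fin_supp_funs_update[OF f cF] a Well_order_antisym[OF r]
        unfolding omega_power_def
        by (auto simp: underS_def fun_eq_iff intro!: bexI[of _ a])
      then show ?thesis
        using i f' fin_supp_funs_update[OF f cF] by (auto simp: underS_def w_iff)
    qed
    have "cb_deriv_at w X (?f', i) = cb_step w X (cb_deriv_at w X) (underS w (?f', i))"
      by (rule cb_deriv_at_unfold[OF Well_order_w])
    also have "\<dots> = omega_step (omega_deriv r) ?C (cb_deriv_at w X (f, i))"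
    proof (rule cb_step_block[OF f i C])
      show "f c = 0" if "c \<in> ?C" for c using f0 that by blast
      show "(f, i) \<in> underS w (?f', i)" using below[of a "f a"] by simp
      show "(f(c := m), i) \<in> underS w (?f', i)" if "c \<in> ?C" for c m using below that by blast
      show "cb_deriv_at w X (f(c := m), i) = (omega_deriv r c ^^ m) (cb_deriv_at w X (f, i))"
        if "c \<in> ?C" for c m
      proof (rule cb_deriv_at_iterate[OF _ f])
        show "f c = 0" "c \<in> Field r" using f0 that C by auto
        show "\<forall>b\<in>underS r c. f b = 0"
          using f0 that Well_order_trans[OF r] Well_order_antisym[OF r] unfolding underS_def by blast
        show "cb_deriv_at w X (g(c := Suc (g c)), i) = omega_deriv r c (cb_deriv_at w X (g, i))"
          if "g \<in> fin_supp_funs r" "\<forall>b\<in>underS r c. g b = 0" for g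
          using IH \<open>c \<in> ?C\<close> C that unfolding underS_def by blast
      qed
      fix q assume q: "q \<in> underS w (?f', i)"
      obtain g j where gj: "q = (g, j)" by (cases q)
      have g: "g \<in> fin_supp_funs r" and j: "j < k" using q gj by (auto simp: underS_def w_iff)
      show "if ?C = {} then (q, (f, i)) \<in> w else \<exists>c\<in>?C. \<exists>m. (q, (f(c := m), i)) \<in> w"
      proof (cases "j < i")
        case True
        have "((g, j), (f, i)) \<in> w" using True f g j i by (simp add: w_iff)
        moreover have "((g, j), (f(c := m), i)) \<in> w" if "c \<in> ?C" for c m
          using True fin_supp_funs_update[OF f] C that g j i by (auto simp: w_iff)
        ultimately show ?thesis unfolding gj by auto
      next
        case False
        then have ji: "j = i" and "(g, ?f') \<in> omega_power r" "g \<noteq> ?f'"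
          using q unfolding gj underS_def by (auto simp: w_iff)
        then obtain b where b: "b \<in> Field r" "g b < ?f' b" "\<And>b'. (b, b') \<in> r \<Longrightarrow> b' \<noteq> b \<Longrightarrow> g b' = ?f' b'"
          unfolding omega_power_def by auto
        \<comment> \<open>Either \<open>g\<close> is decided at \<open>a\<close> with
          \<open>g a = f a\<close>, and then \<open>g\<close> and \<open>f\<close> can differ only
          below \<open>a\<close>; or the deciding argument \<open>b\<close> also witnesses that
          \<open>g\<close> is smaller than \<open>f\<close>, because \<open>f\<close> vanishes below
          \<open>a\<close>.\<close>
        have "(g, f) \<in> omega_power r \<or> (\<forall>b. b \<notin> ?C \<longrightarrow> g b = f b)"
        proof (cases "b = a \<and> g a = f a")
          case True
          have "g b = f b" if "b \<notin> ?C" for b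
          proof (cases "b \<in> Field r")
            case True
            then show ?thesis
              using b \<open>b \<notin> ?C\<close> Well_order_total[OF r True a] \<open>_ = a \<and> _\<close>
              by (cases "b = a") (auto simp: underS_def)
          next
            case False
            then show ?thesis using f g by (simp add: fin_supp_funs_outside)
          qed
          then show ?thesis by blast
        next
          case False
          have "g b < f b \<and> (\<forall>b'. (b, b') \<in> r \<and> b' \<noteq> b \<longrightarrow> g b' = f b')"
          proof (cases "b = a")
            case True
            then show ?thesis using b False by auto
          next
            case neq: False
            then have "g b < f b" using b by simp
            then have "b \<notin> ?C" using f0 by auto
            then have "(a, b) \<in> r" using Well_order_total[OF r b(1) a] neq by (auto simp: underS_def)
            then have "(b, a) \<notin> r" using Well_order_antisym[OF r] neq by blast
            then show ?thesis using b(3) \<open>g b < f b\<close> by (metis fun_upd_other)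
          qed
          then show ?thesis using b(1) f g unfolding omega_power_def by blast
        qed
        note gf = this
        show ?thesis
        proof (cases "?C = {}")
          case True
          then have "(g, f) \<in> omega_power r" using gf f g by (auto simp: omega_power_def)
          then show ?thesis using True f g i by (simp add: gj ji w_iff)
        next
          case False
          then have "\<exists>c\<in>?C. \<exists>m. (g, f(c := m)) \<in> omega_power r"
            using f0 by (intro omega_power_cofinal[OF r f g C _ _ gf]) auto
          then show ?thesis using False g i C fin_supp_funs_update[OF f] by (auto simp: gj ji w_iff)
        qed
      qed
    qed
    also have "\<dots> = omega_deriv r a (cb_deriv_at w X (f, i))"
      by (simp add: omega_deriv_unfold[OF r, of a])
    finally show "cb_deriv_at w X (?f', i) = omega_deriv r a (cb_deriv_at w X (f, i))" .
  qed
  then show ?thesis using assms by blast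
qed

text \<open>The segment below \<open>(?z, i)\<close>, where \<open>?z\<close> is the zero function,
  consists of the first \<open>i\<close> copies of \<open>\<omega>\<^sup>r\<close>. Hence each
  further copy is one block starting at \<open>?z\<close> with \<open>C = Field r\<close>.\<close>

lemma cb_step_blocks:
  assumes "i \<le> k"
  shows "cb_step w X (cb_deriv_at w X) (fin_supp_funs r \<times> {..<i}) =
    (omega_step (omega_deriv r) (Field r) ^^ i) X"
  using assms
proof (induction i)
  case 0
  then show ?case by (simp add: cb_step_def)
next
  case (Suc i)
  let ?z = "\<lambda>_::'o. 0::nat" and ?S = "\<lambda>i. fin_supp_funs r \<times> {..<i::nat}"
  have i: "i < k" using Suc.prems by simp
  have z: "?z \<in> fin_supp_funs r" by (simp add: fin_supp_funs_def)
  have "underS w (?z, i) = ?S i"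
    using z i by (auto simp: underS_def w_iff omega_power_def)
  then have IH: "cb_deriv_at w X (?z, i) = (omega_step (omega_deriv r) (Field r) ^^ i) X"
    using Suc cb_deriv_at_unfold[OF Well_order_w, of X "(?z, i)"] by simp
  have "cb_step w X (cb_deriv_at w X) (?S (Suc i)) =
      omega_step (omega_deriv r) (Field r) (cb_deriv_at w X (?z, i))"
  proof (rule cb_step_block[OF z i])
    show "(?z(c := m), i) \<in> ?S (Suc i)" if "c \<in> Field r" for c m
      using fin_supp_funs_update[OF z that] by simp
    show "cb_deriv_at w X (?z(c := m), i) = (omega_deriv r c ^^ m) (cb_deriv_at w X (?z, i))"
      if "c \<in> Field r" for c m
      by (rule cb_deriv_at_iterate[OF _ z]) (use cb_deriv_at_shift[OF _ i that] that in auto)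
    fix q assume q: "q \<in> ?S (Suc i)"
    obtain g j where gj: "q = (g, j)" by (cases q)
    have g: "g \<in> fin_supp_funs r" and j: "j \<le> i" using q gj by auto
    show "if Field r = {} then (q, (?z, i)) \<in> w else \<exists>c\<in>Field r. \<exists>m. (q, (?z(c := m), i)) \<in> w"
    proof (cases "Field r = {}")
      case True
      then have "g = ?z" using g by (auto simp: fin_supp_funs_def)
      then show ?thesis using True z i j unfolding gj w_iff by (auto simp: omega_power_def)
    next
      case False
      have "g b = ?z b" if "b \<notin> Field r" for b
        using g that by (simp add: fin_supp_funs_outside)
      then obtain c m where "c \<in> Field r" "(g, ?z(c := m)) \<in> omega_power r"
        using omega_power_cofinal[OF r z g subset_refl False] by blast
      moreover from this have "(q, (?z(c := m), i)) \<in> w"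
        using g i j fin_supp_funs_update[OF z] unfolding gj w_iff by auto
      ultimately show ?thesis using False by auto
    qed
  qed (use z in auto)
  then show ?case using IH by simp
qed

text \<open>From here on, iterates of one operator replace transfinite derivatives; only the
  exponent still needs an induction.\<close>

lemma cb_deriv_w: "cb_deriv w X = (omega_step (omega_deriv r) (Field r) ^^ k) X"
  unfolding cb_deriv_def Field_w by (rule cb_step_blocks) simp

end

section \<open>Closed, monotone, subadditive derivations\<close>

definition derivation_op :: "('a::topological_space set \<Rightarrow> 'a set) \<Rightarrow> bool" where
  "derivation_op D \<longleftrightarrow> (\<forall>A. closed A \<longrightarrow> closed (D A)) \<and> (\<forall>A. D A \<subseteq> A) \<and>
     (\<forall>A B. A \<subseteq> B \<longrightarrow> D A \<subseteq> D B) \<and>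
     (\<forall>A B. closed A \<longrightarrow> closed B \<longrightarrow> D (A \<union> B) \<subseteq> D A \<union> D B)"

lemma derivation_opI:
  assumes "\<And>A. closed A \<Longrightarrow> closed (D A)" "\<And>A. D A \<subseteq> A" "\<And>A B. A \<subseteq> B \<Longrightarrow> D A \<subseteq> D B"
    and "\<And>A B. closed A \<Longrightarrow> closed B \<Longrightarrow> D (A \<union> B) \<subseteq> D A \<union> D B"
  shows "derivation_op D"
  using assms unfolding derivation_op_def by simp

lemma derivation_opD:
  assumes "derivation_op D"
  shows derivation_op_closed: "closed A \<Longrightarrow> closed (D A)"
    and derivation_op_subset: "D A \<subseteq> A"
    and derivation_op_mono: "A \<subseteq> B \<Longrightarrow> D A \<subseteq> D B"
    and derivation_op_Un: "closed A \<Longrightarrow> closed B \<Longrightarrow> D (A \<union> B) \<subseteq> D A \<union> D B"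
  using assms unfolding derivation_op_def by simp_all

text \<open>This is the use of subadditivity: \<open>nested_sequence\<close> needs one function that
  is small on several closed sets with empty derivative at once.\<close>

lemma derivation_op_UN:
  assumes D: "derivation_op D" and "finite I"
    and "\<And>i. i \<in> I \<Longrightarrow> closed (L i)" "\<And>i. i \<in> I \<Longrightarrow> D (L i) = {}"
  shows "D (\<Union>i\<in>I. L i) = {}"
  using assms(2-)
proof (induction I)
  case empty
  then show ?case using derivation_op_subset[OF D, of "{}"] by simp
next
  case (insert i I)
  have "D (L i \<union> (\<Union>i\<in>I. L i)) \<subseteq> D (L i) \<union> D (\<Union>i\<in>I. L i)"
    using insert by (intro derivation_op_Un[OF D]) auto
  then show ?case using insert by auto
qed

lemma derivation_op_accum_points: "derivation_op (accum_points :: 'a::t2_space set \<Rightarrow> 'a set)"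
proof (rule derivation_opI)
  fix A B :: "'a set"
  show "closed (accum_points A)" if "closed A"
  proof -
    have "accum_points A = {x. x islimpt A}"
      using that unfolding accum_points_def closed_limpt by auto
    moreover have "x islimpt A" if x: "x islimpt {x. x islimpt A}" for x
      unfolding islimpt_def
    proof (intro allI impI)
      fix U assume "x \<in> U" "open U"
      then obtain y where y: "y islimpt A" "y \<in> U" "y \<noteq> x" using x unfolding islimpt_def by blast
      then obtain z where "z \<in> A" "z \<in> U - {x}"
        using \<open>open U\<close> unfolding islimpt_def by (meson DiffI open_delete singletonD)
      then show "\<exists>y\<in>A. y \<in> U \<and> y \<noteq> x" by blast
    qed
    ultimately show ?thesis by (simp add: closed_limpt)
  qed
  show "accum_points A \<subseteq> A" by (rule accum_points_subset)
  show "accum_points A \<subseteq> accum_points B" if "A \<subseteq> B"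
    using that by (auto simp: accum_points_def intro: islimpt_subset)
  show "accum_points (A \<union> B) \<subseteq> accum_points A \<union> accum_points B" if "closed A" "closed B"
    using that by (auto simp: accum_points_def islimpt_Un closed_limpt)
qed

lemma derivation_op_funpow:
  assumes D: "derivation_op D"
  shows "derivation_op (D ^^ m)"
proof (induction m)
  case 0
  then show ?case by (auto simp: derivation_op_def)
next
  case (Suc m)
  show ?case
  proof (rule derivation_opI)
    fix A B :: "'a set"
    show "closed ((D ^^ Suc m) A)" if "closed A"
      using that D Suc by (simp add: derivation_op_closed)
    show "(D ^^ Suc m) A \<subseteq> A"
      using derivation_op_subset[OF D] derivation_op_subset[OF Suc] by fastforce
    show "(D ^^ Suc m) A \<subseteq> (D ^^ Suc m) B" if "A \<subseteq> B"
      using derivation_op_mono[OF D derivation_op_mono[OF Suc that]] by simp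
    show "(D ^^ Suc m) (A \<union> B) \<subseteq> (D ^^ Suc m) A \<union> (D ^^ Suc m) B" if "closed A" "closed B"
    proof -
      have "D ((D ^^ m) (A \<union> B)) \<subseteq> D ((D ^^ m) A \<union> (D ^^ m) B)"
        by (intro derivation_op_mono[OF D] derivation_op_Un[OF Suc] that)
      also have "\<dots> \<subseteq> D ((D ^^ m) A) \<union> D ((D ^^ m) B)"
        by (intro derivation_op_Un[OF D] derivation_op_closed[OF Suc] that)
      finally show ?thesis by simp
    qed
  qed
qed

lemma funpow_antimono_set:
  assumes D: "\<And>A. D A \<subseteq> A" and "m \<le> n"
  shows "(D ^^ n) A \<subseteq> (D ^^ m) (A :: 'a set)"
  using assms(2)
proof (induction rule: dec_induct)
  case (step n)
  have "(D ^^ Suc n) A \<subseteq> (D ^^ n) A" using D by simp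
  then show ?case using step by blast
qed simp

lemma omega_deriv_subset_funpow:
  assumes r: "Well_order r" and "c \<in> underS r d"
  shows "omega_deriv r d A \<subseteq> (omega_deriv r c ^^ m) A"
  unfolding omega_deriv_unfold[OF r, of d] omega_step_def using assms(2) by auto

text \<open>Of two exponents the larger one prevails, as a single application of its derivative lies
  inside every iterate for the smaller one; for equal exponents the larger number of iterations
  prevails.\<close>

lemma omega_deriv_chain:
  assumes r: "Well_order r" and S: "S \<subseteq> Field r" "c \<in> S" "c' \<in> S"
    and sub: "\<And>c A. c \<in> S \<Longrightarrow> omega_deriv r c A \<subseteq> (A :: 'a::topological_space set)"
  shows "\<exists>d\<in>S. \<exists>n. \<forall>A::'a set. (omega_deriv r d ^^ n) A \<subseteq> (omega_deriv r c ^^ m) A \<and>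
    (omega_deriv r d ^^ n) A \<subseteq> (omega_deriv r c' ^^ m') A"
proof -
  have *: "\<exists>n. \<forall>A::'a set. (omega_deriv r d ^^ n) A \<subseteq> (omega_deriv r c ^^ m) A \<and>
    (omega_deriv r d ^^ n) A \<subseteq> (omega_deriv r d ^^ m') A"
    if "d \<in> S" "c \<in> S" "(c, d) \<in> r" for c d m m'
  proof (cases "c = d")
    case True
    note anti = funpow_antimono_set[of "omega_deriv r d", OF sub[OF that(1)]]
    show ?thesis
      unfolding True by (intro exI[of _ "max m m'"] allI conjI anti) auto
  next
    case False
    then have cd: "c \<in> underS r d" using that by (auto simp: underS_def)
    \<comment> \<open>At least one application of \<open>d\<close> is needed to get below the
      iterates of \<open>c\<close>, also when \<open>m'\<close> is 0.\<close>
    show ?thesis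
    proof (intro exI[of _ "max 1 m'"] allI conjI)
      fix A :: "'a set"
      have "(omega_deriv r d ^^ max 1 m') A \<subseteq> (omega_deriv r d ^^ 1) A"
        by (rule funpow_antimono_set) (use sub that in auto)
      also have "\<dots> \<subseteq> (omega_deriv r c ^^ m) A"
        using omega_deriv_subset_funpow[OF r cd] by simp
      finally show "(omega_deriv r d ^^ max 1 m') A \<subseteq> (omega_deriv r c ^^ m) A" .
      show "(omega_deriv r d ^^ max 1 m') A \<subseteq> (omega_deriv r d ^^ m') A"
        by (rule funpow_antimono_set) (use sub that in auto)
    qed
  qed
  have "(c, c') \<in> r \<or> (c', c) \<in> r" using S by (intro Well_order_total[OF r]) auto
  then show ?thesis
  proof
    assume "(c, c') \<in> r"
    from *[OF S(3,2) this] show ?thesis using S(3) by blast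
  next
    assume "(c', c) \<in> r"
    from *[OF S(2,3) this] show ?thesis using S(2) by blast
  qed
qed

text \<open>The point at issue is subadditivity at a nonzero exponent: a point excluded by one
  iterate of \<open>A\<close> and by another of \<open>B\<close> is excluded by a common iterate of
  both, and iterates are subadditive.\<close>

lemma derivation_op_omega_step:
  assumes r: "Well_order r" and S: "S \<subseteq> Field r"
    and D: "\<And>c. c \<in> S \<Longrightarrow> derivation_op (omega_deriv r c :: 'a::t2_space set \<Rightarrow> 'a set)"
  shows "derivation_op (omega_step (omega_deriv r) S :: 'a set \<Rightarrow> 'a set)"
proof (cases "S = {}")
  case True
  then have "omega_step (omega_deriv r) S = (accum_points :: 'a set \<Rightarrow> 'a set)"
    by (intro ext) (simp add: omega_step_def)
  then show ?thesis by (simp add: derivation_op_accum_points)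
next
  case False
  then have step: "omega_step (omega_deriv r) S A = (\<Inter>c\<in>S. \<Inter>m. (omega_deriv r c ^^ m) A)"
    for A :: "'a set" by (simp add: omega_step_def)
  note pow = derivation_op_funpow[OF D]
  show ?thesis
  proof (rule derivation_opI)
    fix A B :: "'a set"
    show "closed (omega_step (omega_deriv r) S A)" if "closed A"
      unfolding step using derivation_op_closed[OF pow that] by auto
    show "omega_step (omega_deriv r) S A \<subseteq> A"
    proof
      fix x assume "x \<in> omega_step (omega_deriv r) S A"
      moreover obtain c where "c \<in> S" using False by blast
      ultimately have "x \<in> (omega_deriv r c ^^ 0) A" unfolding step by blast
      then show "x \<in> A" by simp
    qed
    show "omega_step (omega_deriv r) S A \<subseteq> omega_step (omega_deriv r) S B" if "A \<subseteq> B"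
      unfolding step using derivation_op_mono[OF pow that] by blast
    show "omega_step (omega_deriv r) S (A \<union> B) \<subseteq>
        omega_step (omega_deriv r) S A \<union> omega_step (omega_deriv r) S B" if "closed A" "closed B"
    proof (rule ccontr)
      assume "\<not> ?thesis"
      then obtain x where x: "x \<in> omega_step (omega_deriv r) S (A \<union> B)"
        and xA: "x \<notin> omega_step (omega_deriv r) S A" and xB: "x \<notin> omega_step (omega_deriv r) S B"
        by blast
      from xA obtain c m where c: "c \<in> S" "x \<notin> (omega_deriv r c ^^ m) A" unfolding step by blast
      from xB obtain c' m' where c': "c' \<in> S" "x \<notin> (omega_deriv r c' ^^ m') B"
        unfolding step by blast
      have sub: "omega_deriv r c A \<subseteq> A" if "c \<in> S" for c and A :: "'a set"
        by (rule derivation_op_subset[OF D[OF that]])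
      obtain d n where d: "d \<in> S" "\<And>A::'a set. (omega_deriv r d ^^ n) A \<subseteq> (omega_deriv r c ^^ m) A \<and>
          (omega_deriv r d ^^ n) A \<subseteq> (omega_deriv r c' ^^ m') A"
        using omega_deriv_chain[OF r S c(1) c'(1) sub] by blast
      have "x \<in> (omega_deriv r d ^^ n) (A \<union> B)" using x d(1) unfolding step by blast
      then have "x \<in> (omega_deriv r d ^^ n) A \<or> x \<in> (omega_deriv r d ^^ n) B"
        using derivation_op_Un[OF pow[OF d(1)] that] by blast
      then show False using d(2) c(2) c'(2) by blast
    qed
  qed
qed

lemma derivation_op_omega_deriv:
  assumes r: "Well_order r"
  shows "derivation_op (omega_deriv r a :: 'a::t2_space set \<Rightarrow> 'a set)"
proof (rule wo_rel.well_order_induct[OF wo_rel.intro[OF r], of _ a])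
  fix a assume IH: "\<forall>b. b \<noteq> a \<and> (b, a) \<in> r \<longrightarrow> derivation_op (omega_deriv r b :: 'a set \<Rightarrow> 'a set)"
  have "derivation_op (omega_step (omega_deriv r) (underS r a) :: 'a set \<Rightarrow> 'a set)"
    by (rule derivation_op_omega_step[OF r]) (use IH in \<open>auto simp: underS_def Field_def\<close>)
  then show "derivation_op (omega_deriv r a :: 'a set \<Rightarrow> 'a set)"
    by (subst omega_deriv_unfold[OF r, abs_def])
qed

text \<open>By \<open>omega_deriv_chain\<close> the iterates form a downward directed family of
  closed subsets of \<open>L\<close>. If all were nonempty, compactness would give a common
  point.\<close>

lemma omega_step_empty:
  fixes L :: "'a::t2_space set"
  assumes r: "Well_order r" and S: "S \<subseteq> Field r" "S \<noteq> {}" and L: "compact L"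
    and "omega_step (omega_deriv r) S L = {}"
  shows "\<exists>c\<in>S. \<exists>m. (omega_deriv r c ^^ m) L = {}"
proof (rule ccontr)
  assume ne: "\<not> ?thesis"
  note D = derivation_op_omega_deriv[OF r]
  let ?f = "\<lambda>(c, m). (omega_deriv r c ^^ m) L"
  have "\<exists>d\<in>S. \<exists>n. ?f (d, n) \<subseteq> (\<Inter>p\<in>I. ?f p)" if "finite I" "I \<subseteq> S \<times> UNIV" for I
    using that
  proof (induction I)
    case empty
    then show ?case using S by auto
  next
    case (insert p I)
    obtain c m where p: "p = (c, m)" "c \<in> S" using insert.prems by auto
    obtain d n where "d \<in> S" and d: "?f (d, n) \<subseteq> (\<Inter>p\<in>I. ?f p)" using insert by auto
    from omega_deriv_chain[OF r S(1) p(2) this(1) derivation_op_subset[OF D], of m n]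
    obtain e k where "e \<in> S" "?f (e, k) \<subseteq> ?f p" "?f (e, k) \<subseteq> ?f (d, n)"
      unfolding p by simp blast
    then show ?case using d by (intro bexI[of _ e] exI[of _ k]) auto
  qed
  note lower = this
  have "L \<inter> (\<Inter>p\<in>I. ?f p) \<noteq> {}" if I: "finite I" "I \<subseteq> S \<times> UNIV" for I
  proof -
    obtain d n where "d \<in> S" "?f (d, n) \<subseteq> (\<Inter>p\<in>I. ?f p)" using lower[OF I] by auto
    moreover have "?f (d, n) \<noteq> {}" using ne \<open>d \<in> S\<close> by auto
    moreover have "?f (d, n) \<subseteq> L" using derivation_op_subset[OF derivation_op_funpow[OF D]] by auto
    ultimately show ?thesis by blast
  qed
  note fip = this
  have "L \<inter> (\<Inter>p\<in>S \<times> UNIV. ?f p) \<noteq> {}"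
  proof (rule compact_imp_fip_image[OF L])
    show "closed (?f p)" for p
      using derivation_op_closed[OF derivation_op_funpow[OF D] compact_imp_closed[OF L]]
      by (cases p) simp
    show "L \<inter> (\<Inter>p\<in>I. ?f p) \<noteq> {}" if "finite I" "I \<subseteq> S \<times> UNIV" for I
      by (rule fip[OF that])
  qed
  then obtain x where x: "\<And>p. p \<in> S \<times> UNIV \<Longrightarrow> x \<in> ?f p" by blast
  have "x \<in> (omega_deriv r c ^^ m) L" if "c \<in> S" for c m
    using x[of "(c, m)"] that by simp
  then have "x \<in> omega_step (omega_deriv r) S L" using S(2) by (simp add: omega_step_def)
  then show False using assms(5) by simp
qed

section \<open>Copies of \<open>c\<^sub>0\<close> and cotype\<close>

text \<open>A quantitative form of weak unconditional Cauchyness of the series with terms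
  \<open>e i\<close>.\<close>

definition bounded_combinations :: "('i \<Rightarrow> 'e::real_normed_vector) \<Rightarrow> 'i set \<Rightarrow> real \<Rightarrow> bool" where
  "bounded_combinations e I B \<longleftrightarrow>
     (\<forall>F a. finite F \<longrightarrow> F \<subseteq> I \<longrightarrow> (\<forall>i\<in>F. \<bar>a i\<bar> \<le> 1) \<longrightarrow> norm (\<Sum>i\<in>F. a i *\<^sub>R e i) \<le> B)"

lemma bounded_combinationsD:
  assumes "bounded_combinations e I B" "finite F" "F \<subseteq> I" "\<And>i. i \<in> F \<Longrightarrow> \<bar>a i\<bar> \<le> 1"
  shows "norm (\<Sum>i\<in>F. a i *\<^sub>R e i) \<le> B"
  using assms unfolding bounded_combinations_def by blast

lemma bounded_combinations_scaled:
  assumes "bounded_combinations e I B" "finite F" "F \<subseteq> I" "\<And>i. i \<in> F \<Longrightarrow> \<bar>a i\<bar> \<le> c" "0 \<le> c"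
  shows "norm (\<Sum>i\<in>F. a i *\<^sub>R e i) \<le> c * B"
proof (cases "c = 0")
  case True
  then have "a i = 0" if "i \<in> F" for i using assms(4)[OF that] by simp
  then show ?thesis using True by simp
next
  case False
  then have c: "0 < c" using assms(5) by simp
  have "norm (\<Sum>i\<in>F. (a i / c) *\<^sub>R e i) \<le> B"
    using assms c by (intro bounded_combinationsD[OF assms(1-3)]) (simp add: field_simps)
  moreover have "(\<Sum>i\<in>F. a i *\<^sub>R e i) = c *\<^sub>R (\<Sum>i\<in>F. (a i / c) *\<^sub>R e i)"
    using c by (simp add: scaleR_sum_right)
  ultimately show ?thesis using c by simp
qed

text \<open>The hypothesis says that every infinite set \<open>N\<close> contains an \<open>i\<close> such that \<open>e i\<close> is
  nearly a combination of the \<open>e j\<close> with \<open>j \<in> N - {i}\<close>. Applying it to the cells of a partition,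
  and then to a set of representatives, yields nearly equal combinations with disjoint supports,
  and their sum grows linearly.\<close>

lemma multiple_near_combination:
  fixes e :: "nat \<Rightarrow> 'e::real_normed_vector"
  assumes bad: "\<And>N. infinite N \<Longrightarrow> \<exists>i\<in>N. \<exists>F a. finite F \<and> F \<subseteq> N - {i} \<and> (\<forall>j\<in>F. \<bar>a j\<bar> \<le> 1) \<and>
      norm (e i + (\<Sum>j\<in>F. a j *\<^sub>R e j)) < \<delta>"
  shows "\<exists>N. infinite N \<and> (\<forall>i\<in>N. \<exists>F a. finite F \<and> F \<inter> N = {} \<and> (\<forall>j\<in>F. \<bar>a j\<bar> \<le> 1) \<and>
      norm (real m *\<^sub>R e i + (\<Sum>j\<in>F. a j *\<^sub>R e j)) \<le> real m * \<delta>)"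
proof (induction m)
  case 0
  show ?case by (rule exI[of _ UNIV]) (auto intro!: exI[of _ "{}"])
next
  case (Suc m)
  then obtain N where N: "infinite N" and old: "\<forall>i\<in>N. \<exists>F a. finite F \<and> F \<inter> N = {} \<and>
      (\<forall>j\<in>F. \<bar>a j\<bar> \<le> 1) \<and> norm (real m *\<^sub>R e i + (\<Sum>j\<in>F. a j *\<^sub>R e j)) \<le> real m * \<delta>" by blast
  \<comment> \<open>Pairing splits indices of \<open>N\<close> into infinitely many disjoint
    infinite cells; the representatives \<open>i p\<close> of the cells will form the next
    set.\<close>
  define P where "P p = range (\<lambda>q. enumerate N (prod_encode (p, q)))" for p
  have inj: "enumerate N (prod_encode x) = enumerate N (prod_encode y) \<longleftrightarrow> x = y" for x y
    using inj_eq[OF inj_enumerate[OF N]] by (simp add: prod_encode_eq)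
  have "infinite (P p)" for p
    unfolding P_def by (rule range_inj_infinite) (auto intro: injI simp: inj)
  then have "\<forall>p. \<exists>i F a. i \<in> P p \<and> finite F \<and> F \<subseteq> P p - {i} \<and> (\<forall>j\<in>F. \<bar>a j\<bar> \<le> 1) \<and>
      norm (e i + (\<Sum>j\<in>F. a j *\<^sub>R e j)) < \<delta>"
    using bad by blast
  from choice[OF this] obtain i where "\<forall>p. \<exists>F a. i p \<in> P p \<and> finite F \<and> F \<subseteq> P p - {i p} \<and>
      (\<forall>j\<in>F. \<bar>a j\<bar> \<le> 1) \<and> norm (e (i p) + (\<Sum>j\<in>F. a j *\<^sub>R e j)) < \<delta>" ..
  from choice[OF this] obtain F where "\<forall>p. \<exists>a. i p \<in> P p \<and> finite (F p) \<and> F p \<subseteq> P p - {i p} \<and>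
      (\<forall>j\<in>F p. \<bar>a j\<bar> \<le> 1) \<and> norm (e (i p) + (\<Sum>j\<in>F p. a j *\<^sub>R e j)) < \<delta>" ..
  from choice[OF this] obtain a where all: "\<forall>p. i p \<in> P p \<and> finite (F p) \<and> F p \<subseteq> P p - {i p} \<and>
      (\<forall>j\<in>F p. \<bar>a p j\<bar> \<le> 1) \<and> norm (e (i p) + (\<Sum>j\<in>F p. a p j *\<^sub>R e j)) < \<delta>" ..
  then have i: "\<And>p. i p \<in> P p" and F: "\<And>p. finite (F p)" "\<And>p. F p \<subseteq> P p - {i p}"
    and a: "\<And>p j. j \<in> F p \<Longrightarrow> \<bar>a p j\<bar> \<le> 1"
    and small: "\<And>p. norm (e (i p) + (\<Sum>j\<in>F p. a p j *\<^sub>R e j)) < \<delta>"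
    by blast+
  have PN: "P p \<subseteq> N" for p unfolding P_def using enumerate_in_set[OF N] by auto
  have disj: "p = q" if "x \<in> P p" "x \<in> P q" for x p q using that by (auto simp: P_def inj)
  have "inj i"
  proof (rule injI)
    fix p q assume "i p = i q"
    then show "p = q" using disj[of "i p" p q] i[of p] i[of q] by simp
  qed
  then have "infinite (range i)" by (rule range_inj_infinite)
  moreover have "\<exists>G b. finite G \<and> G \<inter> range i = {} \<and> (\<forall>j\<in>G. \<bar>b j\<bar> \<le> 1) \<and>
      norm (real (Suc m) *\<^sub>R e (i p) + (\<Sum>j\<in>G. b j *\<^sub>R e j)) \<le> real (Suc m) * \<delta>" for p
  proof -
    have "i p \<in> N" using i PN by blast
    from bspec[OF old this] obtain G b where G: "finite G" "G \<inter> N = {}" "\<forall>j\<in>G. \<bar>b j\<bar> \<le> 1"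
      and Gb: "norm (real m *\<^sub>R e (i p) + (\<Sum>j\<in>G. b j *\<^sub>R e j)) \<le> real m * \<delta>"
      by (elim exE conjE)
    \<comment> \<open>\<open>G\<close> avoids \<open>N\<close> and \<open>F p\<close> lies inside
      it, so the two combinations have disjoint supports and the glued coefficients are still at
      most 1 in modulus.\<close>
    define c where "c j = (if j \<in> G then b j else a p j)" for j
    have GF: "G \<inter> F p = {}" using G F PN by blast
    have "(\<Sum>j\<in>G \<union> F p. c j *\<^sub>R e j) = (\<Sum>j\<in>G. c j *\<^sub>R e j) + (\<Sum>j\<in>F p. c j *\<^sub>R e j)"
      by (rule sum.union_disjoint[OF G(1) F(1) GF])
    also have "(\<Sum>j\<in>G. c j *\<^sub>R e j) = (\<Sum>j\<in>G. b j *\<^sub>R e j)" by (simp add: c_def)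
    also have "(\<Sum>j\<in>F p. c j *\<^sub>R e j) = (\<Sum>j\<in>F p. a p j *\<^sub>R e j)"
      using GF by (intro sum.cong) (auto simp: c_def)
    finally have "real (Suc m) *\<^sub>R e (i p) + (\<Sum>j\<in>G \<union> F p. c j *\<^sub>R e j) =
        (real m *\<^sub>R e (i p) + (\<Sum>j\<in>G. b j *\<^sub>R e j)) + (e (i p) + (\<Sum>j\<in>F p. a p j *\<^sub>R e j))"
      by (simp add: scaleR_add_left)
    then have "norm (real (Suc m) *\<^sub>R e (i p) + (\<Sum>j\<in>G \<union> F p. c j *\<^sub>R e j)) \<le> real m * \<delta> + \<delta>"
      using norm_triangle_mono[OF Gb less_imp_le[OF small[of p]]] by simp
    moreover have "(G \<union> F p) \<inter> range i = {}"
    proof -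
      have "G \<inter> range i = {}" using G(2) i PN by blast
      moreover have "i q \<notin> F p" for q
      proof
        assume "i q \<in> F p"
        then have "i q \<in> P p" "i q \<noteq> i p" using F(2) by blast+
        then show False using disj[of "i q" p q] i[of q] by simp
      qed
      ultimately show ?thesis by blast
    qed
    moreover have "\<forall>j\<in>G \<union> F p. \<bar>c j\<bar> \<le> 1" using G(3) a by (auto simp: c_def)
    ultimately show ?thesis using G(1) F(1) by (intro exI[of _ "G \<union> F p"] exI[of _ c]) (simp add: algebra_simps)
  qed
  ultimately show ?case by (intro exI[of _ "range i"]) blast
qed

text \<open>Otherwise some multiple \<open>real m *\<^sub>R e i\<close> would be within
  \<open>real m * (\<epsilon> / 2)\<close> of a combination of norm at most \<open>B\<close>, which
  is impossible for large \<open>m\<close> because its norm is at least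
  \<open>real m * \<epsilon>\<close>.\<close>

lemma exists_separated_subsequence:
  fixes e :: "nat \<Rightarrow> 'e::real_normed_vector"
  assumes B: "bounded_combinations e UNIV B" and "0 < \<epsilon>" and low: "\<And>i. \<epsilon> \<le> norm (e i)"
  shows "\<exists>N. infinite N \<and> (\<forall>i\<in>N. \<forall>F a. finite F \<longrightarrow> F \<subseteq> N - {i} \<longrightarrow> (\<forall>j\<in>F. \<bar>a j\<bar> \<le> 1) \<longrightarrow>
      \<epsilon> / 2 \<le> norm (e i + (\<Sum>j\<in>F. a j *\<^sub>R e j)))"
proof (rule ccontr)
  assume neg: "\<not> ?thesis"
  have bad: "\<exists>i\<in>N. \<exists>F a. finite F \<and> F \<subseteq> N - {i} \<and> (\<forall>j\<in>F. \<bar>a j\<bar> \<le> 1) \<and>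
      norm (e i + (\<Sum>j\<in>F. a j *\<^sub>R e j)) < \<epsilon> / 2" if "infinite N" for N
  proof (rule ccontr)
    assume good: "\<not> ?thesis"
    have "\<epsilon> / 2 \<le> norm (e i + (\<Sum>j\<in>F. a j *\<^sub>R e j))"
      if "i \<in> N" "finite F" "F \<subseteq> N - {i}" "\<forall>j\<in>F. \<bar>a j\<bar> \<le> 1" for i F a
      by (rule leI, rule notI) (use good that in blast)
    note good' = this
    have "\<exists>N. infinite N \<and> (\<forall>i\<in>N. \<forall>F a. finite F \<longrightarrow> F \<subseteq> N - {i} \<longrightarrow> (\<forall>j\<in>F. \<bar>a j\<bar> \<le> 1) \<longrightarrow>
      \<epsilon> / 2 \<le> norm (e i + (\<Sum>j\<in>F. a j *\<^sub>R e j)))"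
      by (intro exI[of _ N] conjI ballI allI impI) (rule \<open>infinite N\<close>, rule good')
    then show False using neg by contradiction
  qed
  obtain m :: nat where m: "B < real m * (\<epsilon> / 2)"
    using reals_Archimedean3[of "\<epsilon> / 2"] \<open>0 < \<epsilon>\<close> by auto
  have "\<exists>N. infinite N \<and> (\<forall>i\<in>N. \<exists>F a. finite F \<and> F \<inter> N = {} \<and> (\<forall>j\<in>F. \<bar>a j\<bar> \<le> 1) \<and>
      norm (real m *\<^sub>R e i + (\<Sum>j\<in>F. a j *\<^sub>R e j)) \<le> real m * (\<epsilon> / 2))"
    by (rule multiple_near_combination) (rule bad)
  then obtain N where "infinite N" and N: "\<forall>i\<in>N. \<exists>F a. finite F \<and> F \<inter> N = {} \<and>
      (\<forall>j\<in>F. \<bar>a j\<bar> \<le> 1) \<and> norm (real m *\<^sub>R e i + (\<Sum>j\<in>F. a j *\<^sub>R e j)) \<le> real m * (\<epsilon> / 2)"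
    by (elim exE conjE)
  then obtain i where "i \<in> N" by (metis all_not_in_conv finite.emptyI)
  from bspec[OF N this] obtain F a where F: "finite F" "\<forall>j\<in>F. \<bar>a j\<bar> \<le> 1"
    and near: "norm (real m *\<^sub>R e i + (\<Sum>j\<in>F. a j *\<^sub>R e j)) \<le> real m * (\<epsilon> / 2)"
    by (elim exE conjE)
  have "norm (\<Sum>j\<in>F. a j *\<^sub>R e j) \<le> B" using bounded_combinationsD[OF B F(1)] F(2) by simp
  then have "norm (real m *\<^sub>R e i) \<le> real m * (\<epsilon> / 2) + B"
    using near norm_triangle_ineq4[of "real m *\<^sub>R e i + (\<Sum>j\<in>F. a j *\<^sub>R e j)" "\<Sum>j\<in>F. a j *\<^sub>R e j"]
    by simp
  moreover have "real m * \<epsilon> \<le> norm (real m *\<^sub>R e i)" using low[of i] by (simp add: mult_left_mono)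
  ultimately show False using m by (simp add: field_simps)
qed

lemma bcontfun_nat_ex:
  fixes f :: "nat \<Rightarrow>\<^sub>C real"
  assumes "f \<in> c0" "f \<noteq> 0"
  shows "\<exists>i. \<bar>f i\<bar> = norm f"
proof -
  obtain j where j: "f j \<noteq> 0" using assms(2) by (metis bcontfun_eqI zero_bcontfun.rep_eq)
  have lim: "apply_bcontfun f \<longlonglongrightarrow> 0" using assms(1) by (simp add: c0_def)
  obtain n where n: "\<And>i. n \<le> i \<Longrightarrow> \<bar>f i\<bar> < \<bar>f j\<bar>"
    using LIMSEQ_D[OF lim, of "\<bar>f j\<bar>"] j by auto
  have "j < n" using n[of j] by (meson linorder_not_le order_less_irrefl)
  obtain i where "i \<in> {..<n}" and i: "\<And>l. l < n \<Longrightarrow> \<bar>f l\<bar> \<le> \<bar>f i\<bar>"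
  proof -
    let ?V = "(\<lambda>i. \<bar>f i\<bar>) ` {..<n}"
    have "Max ?V \<in> ?V" using \<open>j < n\<close> by (intro Max_in) auto
    then obtain i where i: "i \<in> {..<n}" "Max ?V = \<bar>f i\<bar>" by auto
    have "\<bar>f l\<bar> \<le> \<bar>f i\<bar>" if "l < n" for l
      unfolding i(2)[symmetric] using that by (intro Max_ge) auto
    then show ?thesis using i(1) by (intro that)
  qed
  have le: "\<bar>f l\<bar> \<le> \<bar>f i\<bar>" for l
    using i[of l] i[OF \<open>j < n\<close>] n[of l] by (cases "l < n") auto
  have "norm f = \<bar>f i\<bar>"
  proof (rule antisym)
    show "norm f \<le> \<bar>f i\<bar>" by (rule norm_bound) (use le in simp)
    show "\<bar>f i\<bar> \<le> norm f" using norm_bounded[of f i] by simp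
  qed
  then show ?thesis by metis
qed

text \<open>The embedding sends \<open>f\<close> to the series with terms
  \<open>f i *\<^sub>R e i\<close>, which converges since the coefficients tend to 0. For the lower
  bound, the coordinate where the norm of \<open>f\<close> is attained is factored out; the
  remaining quotients are at most 1 in modulus, so \<open>sep\<close> applies.\<close>

lemma contains_copy_of_c0I:
  fixes e :: "nat \<Rightarrow> 'e::banach"
  assumes B: "bounded_combinations e UNIV B" and \<delta>: "0 < \<delta>"
    and sep: "\<And>i F a. finite F \<Longrightarrow> i \<notin> F \<Longrightarrow> (\<forall>j\<in>F. \<bar>a j\<bar> \<le> 1) \<Longrightarrow>
      \<delta> \<le> norm (e i + (\<Sum>j\<in>F. a j *\<^sub>R e j))"
  shows "contains_copy_of_c0 TYPE('e)"
proof -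
  define S where "S f = (\<Sum>i. apply_bcontfun f i *\<^sub>R e i)" for f :: "nat \<Rightarrow>\<^sub>C real"
  have B0: "0 \<le> B" using bounded_combinationsD[OF B, of "{}"] by simp
  have summable: "summable (\<lambda>i. f i *\<^sub>R e i)" if "f \<in> c0" for f :: "nat \<Rightarrow>\<^sub>C real"
    unfolding summable_Cauchy
  proof (intro allI impI)
    fix \<eta> :: real assume \<eta>: "0 < \<eta>"
    have lim: "apply_bcontfun f \<longlonglongrightarrow> 0" using that by (simp add: c0_def)
    obtain N where N: "\<And>i. N \<le> i \<Longrightarrow> \<bar>f i\<bar> < \<eta> / (B + 1)"
      using LIMSEQ_D[OF lim, of "\<eta> / (B + 1)"] \<eta> B0 by auto
    have "norm (\<Sum>i\<in>{m..<n}. f i *\<^sub>R e i) < \<eta>" if "N \<le> m" for m n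
    proof -
      have "norm (\<Sum>i\<in>{m..<n}. f i *\<^sub>R e i) \<le> \<eta> / (B + 1) * B"
        using N that \<eta> B0 by (intro bounded_combinations_scaled[OF B]) (auto intro: less_imp_le)
      also have "\<dots> < \<eta>" using \<eta> B0 by (simp add: field_simps)
      finally show ?thesis .
    qed
    then show "\<exists>N. \<forall>m\<ge>N. \<forall>n. norm (\<Sum>i\<in>{m..<n}. f i *\<^sub>R e i) < \<eta>" by blast
  qed
  have c0_add: "f + g \<in> c0" if "f \<in> c0" "g \<in> c0" for f g
    using that tendsto_add[of "apply_bcontfun f" 0 sequentially "apply_bcontfun g" 0]
    by (simp add: c0_def plus_bcontfun.rep_eq[abs_def])
  have c0_scale: "c *\<^sub>R f \<in> c0" if "f \<in> c0" for f c
    using that tendsto_mult_right_zero[of "apply_bcontfun f" sequentially c]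
    by (simp add: c0_def scaleR_bcontfun.rep_eq[abs_def])
  have add: "S (f + g) = S f + S g" if "f \<in> c0" "g \<in> c0" for f g
    unfolding S_def suminf_add[OF summable[OF that(1)] summable[OF that(2)]]
    by (simp add: scaleR_add_left)
  have scale: "S (c *\<^sub>R f) = c *\<^sub>R S f" if "f \<in> c0" for f c
    unfolding S_def suminf_scaleR_right[OF summable[OF that]] by simp
  have lim: "(\<lambda>n. norm (\<Sum>i<n. f i *\<^sub>R e i)) \<longlonglongrightarrow> norm (S f)" if "f \<in> c0" for f
    unfolding S_def by (intro tendsto_norm summable_LIMSEQ summable that)
  have upper: "norm (S f) \<le> B * norm f" if "f \<in> c0" for f
  proof (rule LIMSEQ_le_const2[OF lim[OF that]], intro exI[of _ 0] allI impI)
    fix n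
    have "norm (\<Sum>i<n. f i *\<^sub>R e i) \<le> norm f * B"
      using norm_bounded[of f] by (intro bounded_combinations_scaled[OF B]) auto
    then show "norm (\<Sum>i<n. f i *\<^sub>R e i) \<le> B * norm f" by (simp add: mult.commute)
  qed
  have lower: "\<delta> * norm f \<le> norm (S f)" if f: "f \<in> c0" for f
  proof (cases "f = 0")
    case False
    obtain i where i: "\<bar>f i\<bar> = norm f" using bcontfun_nat_ex[OF f False] by blast
    then have fi: "f i \<noteq> 0" using False by auto
    show ?thesis
    proof (rule LIMSEQ_le_const[OF lim[OF f]], intro exI[of _ "Suc i"] allI impI)
      fix n assume n: "Suc i \<le> n"
      have "(\<Sum>j<n. f j *\<^sub>R e j) = f i *\<^sub>R e i + (\<Sum>j\<in>{..<n} - {i}. f j *\<^sub>R e j)"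
        using n by (intro sum.remove) auto
      also have "\<dots> = f i *\<^sub>R (e i + (\<Sum>j\<in>{..<n} - {i}. (f j / f i) *\<^sub>R e j))"
        using fi by (simp add: scaleR_add_right scaleR_sum_right)
      finally have "norm (\<Sum>j<n. f j *\<^sub>R e j) =
          norm f * norm (e i + (\<Sum>j\<in>{..<n} - {i}. (f j / f i) *\<^sub>R e j))" using i by simp
      moreover have "\<bar>f j / f i\<bar> \<le> 1" for j
        using norm_bounded[of f j] i fi by (simp add: abs_divide divide_le_eq_1)
      then have "\<delta> \<le> norm (e i + (\<Sum>j\<in>{..<n} - {i}. (f j / f i) *\<^sub>R e j))"
        by (intro sep) auto
      ultimately show "\<delta> * norm f \<le> norm (\<Sum>j<n. f j *\<^sub>R e j)"
        by (simp add: mult.commute[of \<delta>] mult_left_mono)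
    qed
  qed simp
  have inj: "inj_on S c0"
  proof (rule inj_onI)
    fix f g assume fg: "f \<in> c0" "g \<in> c0" "S f = S g"
    have "(-1) *\<^sub>R g \<in> c0" by (rule c0_scale[OF fg(2)])
    then have "S (f + (-1) *\<^sub>R g) = 0" using fg by (simp only: add scale) simp
    moreover have "f + (-1) *\<^sub>R g \<in> c0" by (intro c0_add c0_scale fg)
    ultimately have "\<delta> * norm (f + (-1) *\<^sub>R g) \<le> 0" using lower by fastforce
    then have "norm (f + (-1) *\<^sub>R g) = 0" using \<delta> by (simp add: mult_le_0_iff)
    then show "f = g" by simp
  qed
  have "isomorphic_embedding_on c0 S"
    unfolding isomorphic_embedding_on_def
  proof (intro conjI ballI allI)
    show "\<exists>B. \<forall>x\<in>c0. norm (S x) \<le> B * norm x" using upper by blast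
    show "\<exists>B. \<forall>y\<in>S ` c0. norm (inv_into c0 S y) \<le> B * norm y"
    proof (intro exI[of _ "1 / \<delta>"] ballI)
      fix y assume "y \<in> S ` c0"
      then have "inv_into c0 S y \<in> c0" "S (inv_into c0 S y) = y"
        by (rule inv_into_into, rule f_inv_into_f)
      then show "norm (inv_into c0 S y) \<le> 1 / \<delta> * norm y"
        using lower[of "inv_into c0 S y"] \<delta> by (simp add: field_simps)
    qed
  qed (use add scale inj in auto)
  then show ?thesis unfolding contains_copy_of_c0_def by blast
qed

text \<open>A form of the Bessaga--Pelczynski theorem.\<close>

lemma bounded_combinations_imp_c0:
  fixes e :: "nat \<Rightarrow> 'e::banach"
  assumes B: "bounded_combinations e UNIV B" and "0 < \<epsilon>" and "\<And>i. \<epsilon> \<le> norm (e i)"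
  shows "contains_copy_of_c0 TYPE('e)"
proof -
  obtain N where N: "infinite N" and sep: "\<And>i F a. i \<in> N \<Longrightarrow> finite F \<Longrightarrow> F \<subseteq> N - {i} \<Longrightarrow>
      (\<forall>j\<in>F. \<bar>a j\<bar> \<le> 1) \<Longrightarrow> \<epsilon> / 2 \<le> norm (e i + (\<Sum>j\<in>F. a j *\<^sub>R e j))"
    using exists_separated_subsequence[OF assms] by (elim exE conjE) blast
  let ?\<nu> = "enumerate N"
  have inj: "inj ?\<nu>" by (rule inj_enumerate[OF N])
  have sums: "(\<Sum>j\<in>F. a j *\<^sub>R e (?\<nu> j)) = (\<Sum>j\<in>?\<nu> ` F. a (inv ?\<nu> j) *\<^sub>R e j)" for F a
    by (subst sum.reindex) (auto intro: inj_on_subset[OF inj] simp: inv_f_f[OF inj])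
  show ?thesis
  proof (rule contains_copy_of_c0I)
    show "bounded_combinations (e \<circ> ?\<nu>) UNIV B"
      unfolding bounded_combinations_def
    proof (intro allI impI)
      fix F and a :: "nat \<Rightarrow> real" assume "finite F" "\<forall>i\<in>F. \<bar>a i\<bar> \<le> 1"
      then show "norm (\<Sum>i\<in>F. a i *\<^sub>R (e \<circ> ?\<nu>) i) \<le> B"
        unfolding comp_def sums
        by (intro bounded_combinationsD[OF B]) (auto simp: inv_f_f[OF inj])
    qed
    show "0 < \<epsilon> / 2" using \<open>0 < \<epsilon>\<close> by simp
    fix i F and a :: "nat \<Rightarrow> real" assume "finite F" "i \<notin> F" "\<forall>j\<in>F. \<bar>a j\<bar> \<le> 1"
    then show "\<epsilon> / 2 \<le> norm ((e \<circ> ?\<nu>) i + (\<Sum>j\<in>F. a j *\<^sub>R (e \<circ> ?\<nu>) j))"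
      unfolding comp_def sums using enumerate_in_set[OF N] inj_eq[OF inj]
      by (intro sep) (auto simp: inv_f_f[OF inj])
  qed
qed

text \<open>Rademacher sums have coefficients of modulus at most 1, hence norm at most
  \<open>B\<close>, so cotype bounds \<open>card I * \<epsilon> powr q\<close> by
  \<open>(C * B) powr q\<close>. The bound depends on neither the index set nor the vectors.\<close>

lemma nontrivial_cotype_card_bound:
  assumes "nontrivial_cotype TYPE('e::banach)" and \<epsilon>: "0 < \<epsilon>"
  shows "\<exists>M. \<forall>I (e :: 'i \<Rightarrow> 'e). finite I \<longrightarrow> (\<forall>i\<in>I. \<epsilon> \<le> norm (e i)) \<longrightarrow>
    bounded_combinations e I B \<longrightarrow> card I \<le> M"
proof -
  obtain q C where q: "2 \<le> q" and C: "0 < C"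
    and cot: "\<And>n (e :: nat \<Rightarrow> 'e). 1 \<le> n \<Longrightarrow> (\<Sum>i=1..n. norm (e i) powr q) powr (1 / q)
        \<le> C * sqrt (integral {0..1} (\<lambda>t. (norm (\<Sum>i=1..n. rademacher i t *\<^sub>R e i))\<^sup>2))"
    using assms(1) unfolding nontrivial_cotype_def by blast
  show ?thesis
  proof (intro exI[of _ "nat \<lceil>(C * B / \<epsilon>) powr q\<rceil>"] allI impI)
    fix I :: "'i set" and e :: "'i \<Rightarrow> 'e"
    assume I: "finite I" and low: "\<forall>i\<in>I. \<epsilon> \<le> norm (e i)" and B: "bounded_combinations e I B"
    have B0: "0 \<le> B" using bounded_combinationsD[OF B, of "{}"] by simp
    show "card I \<le> nat \<lceil>(C * B / \<epsilon>) powr q\<rceil>"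
    proof (cases "card I = 0")
      case False
      let ?n = "card I"
      obtain h where h: "bij_betw h {1..?n} I" using ex_bij_betw_nat_finite_1[OF I] by blast
      have inj: "inj_on h {1..?n}" and hI: "h ` {1..?n} = I" using h by (auto simp: bij_betw_def)
      have "norm (\<Sum>i=1..?n. rademacher i t *\<^sub>R e (h i)) \<le> B" for t
      proof -
        have "(\<Sum>i=1..?n. rademacher i t *\<^sub>R e (h i)) =
            (\<Sum>j\<in>I. rademacher (the_inv_into {1..?n} h j) t *\<^sub>R e j)"
          unfolding sum.reindex_bij_betw[OF h, symmetric]
          by (intro sum.cong refl) (simp only: the_inv_into_f_f[OF inj])
        also have "norm \<dots> \<le> B"
          by (rule bounded_combinationsD[OF B I]) (auto simp: rademacher_def abs_sgn_eq)
        finally show ?thesis .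
      qed
      then have sq: "(norm (\<Sum>i=1..?n. rademacher i t *\<^sub>R e (h i)))\<^sup>2 \<le> B\<^sup>2" for t
        by (intro power_mono) auto
      have "integral {0..1} (\<lambda>t. (norm (\<Sum>i=1..?n. rademacher i t *\<^sub>R e (h i)))\<^sup>2) \<le> B\<^sup>2"
      \<comment> \<open>For a non-integrable function \<open>integral\<close> has the default value
        0, which also satisfies the bound.\<close>
      proof (cases "(\<lambda>t. (norm (\<Sum>i=1..?n. rademacher i t *\<^sub>R e (h i)))\<^sup>2) integrable_on {0..1}")
        case True
        then have "integral {0..1} (\<lambda>t. (norm (\<Sum>i=1..?n. rademacher i t *\<^sub>R e (h i)))\<^sup>2)
            \<le> integral {0..1::real} (\<lambda>t. B\<^sup>2)"
          using sq by (intro integral_le) auto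
        then show ?thesis by simp
      next
        case False
        then show ?thesis by (simp add: not_integrable_integral)
      qed
      then have "sqrt (integral {0..1} (\<lambda>t. (norm (\<Sum>i=1..?n. rademacher i t *\<^sub>R e (h i)))\<^sup>2)) \<le> B"
        using B0 real_le_lsqrt by (intro real_le_lsqrt) auto
      then have "(\<Sum>i=1..?n. norm (e (h i)) powr q) powr (1 / q) \<le> C * B"
        using cot[of ?n "\<lambda>i. e (h i)"] False C
        by (smt (verit, best) One_nat_def Suc_leI mult_left_mono neq0_conv)
      moreover have "(real ?n * \<epsilon> powr q) powr (1 / q) \<le> (\<Sum>i=1..?n. norm (e (h i)) powr q) powr (1 / q)"
      proof (rule powr_mono2)
        have "(\<Sum>i=1..?n. \<epsilon> powr q) \<le> (\<Sum>i=1..?n. norm (e (h i)) powr q)"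
          using low hI \<epsilon> q by (intro sum_mono powr_mono2) auto
        then show "real ?n * \<epsilon> powr q \<le> (\<Sum>i=1..?n. norm (e (h i)) powr q)" by simp
      qed (use q in auto)
      ultimately have "(real ?n * \<epsilon> powr q) powr (1 / q) \<le> C * B" by linarith
      then have "((real ?n * \<epsilon> powr q) powr (1 / q)) powr q \<le> (C * B) powr q"
        using q by (intro powr_mono2) auto
      then have "real ?n * \<epsilon> powr q \<le> (C * B) powr q"
        using q \<epsilon> by (simp add: powr_powr)
      then have "real ?n \<le> (C * B / \<epsilon>) powr q"
        using \<epsilon> B0 C by (simp add: powr_divide field_simps)
      then show ?thesis by linarith
    qed simp
  qed
qed

section \<open>Nested bump functions\<close>

text \<open>Separate \<open>x\<close> from another point of \<open>A\<close> in the current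
  neighbourhood, keep the neighbourhood of that point, and continue inside that of
  \<open>x\<close>.\<close>

lemma islimpt_disjoint_open_sequence:
  fixes x :: "'a::t2_space"
  assumes x: "x islimpt A" and V: "open V" "x \<in> V"
  shows "\<exists>U :: nat \<Rightarrow> 'a set. (\<forall>j. open (U j) \<and> U j \<subseteq> V \<and> U j \<inter> A \<noteq> {}) \<and>
    (\<forall>i j. i \<noteq> j \<longrightarrow> U i \<inter> U j = {})"
proof -
  \<comment> \<open>The first component is the set chosen, the second the neighbourhood of
    \<open>x\<close> in which all later choices are made.\<close>
  define good where "good p \<longleftrightarrow> open (fst p) \<and> fst p \<subseteq> V \<and> fst p \<inter> A \<noteq> {} \<and>
    open (snd p) \<and> x \<in> snd p \<and> fst p \<inter> snd p = {}" for p :: "'a set \<times> 'a set"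
  have ex: "\<exists>p. good p \<and> fst p \<subseteq> Q \<and> snd p \<subseteq> Q" if "open Q" "x \<in> Q" for Q
  proof -
    have "open (Q \<inter> V)" "x \<in> Q \<inter> V" using that V by auto
    then obtain y where y: "y \<in> A" "y \<in> Q \<inter> V" "y \<noteq> x" using x unfolding islimpt_def by blast
    obtain P R where "open P" "open R" "y \<in> P" "x \<in> R" "P \<inter> R = {}" using hausdorff[OF y(3)] by blast
    then show ?thesis using y V that
      by (intro exI[of _ "(P \<inter> Q \<inter> V, R \<inter> Q)"]) (auto simp: good_def)
  qed
  have "\<exists>f. \<forall>n. good (f n) \<and> (fst (f (Suc n)) \<subseteq> snd (f n) \<and> snd (f (Suc n)) \<subseteq> snd (f n))"
  proof (rule dependent_nat_choice)
    show "\<exists>p. good p" using ex[of UNIV] by auto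
    show "\<exists>p'. good p' \<and> fst p' \<subseteq> snd p \<and> snd p' \<subseteq> snd p" if "good p" for p :: "'a set \<times> 'a set" and n :: nat
      using ex[of "snd p"] that by (simp add: good_def)
  qed
  then obtain f where f: "\<And>n. good (f n)" "\<And>n. fst (f (Suc n)) \<subseteq> snd (f n)"
    "\<And>n. snd (f (Suc n)) \<subseteq> snd (f n)" by blast
  have "fst (f j) \<subseteq> snd (f i)" if ij: "i < j" for i j
  proof -
    obtain l where l: "j = Suc l" "i \<le> l" using ij by (cases j) auto
    have "snd (f l) \<subseteq> snd (f i)" using lift_Suc_antimono_le[of "\<lambda>n. snd (f n)", OF f(3) l(2)] .
    then show ?thesis using f(2)[of l] l by blast
  qed
  then have "fst (f i) \<inter> fst (f j) = {}" if "i < j" for i j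
    using that f(1)[of i] unfolding good_def by blast
  then have "fst (f i) \<inter> fst (f j) = {}" if "i \<noteq> j" for i j
    using that by (metis inf_commute nat_neq_iff)
  then show ?thesis using f(1) by (intro exI[of _ "\<lambda>n. fst (f n)"]) (auto simp: good_def)
qed

section \<open>Bump functions and their images\<close>

lemma apply_bcontfun_sum:
  "apply_bcontfun (\<Sum>i\<in>F. g i) x = (\<Sum>i\<in>F. apply_bcontfun (g i) x)"
  by (induction F rule: infinite_finite_induct) auto

definition bump_in :: "('a::topological_space \<Rightarrow>\<^sub>C real) \<Rightarrow> 'a set \<Rightarrow> bool" where
  "bump_in f V \<longleftrightarrow> (\<forall>x. 0 \<le> f x \<and> f x \<le> 1) \<and> (\<forall>x. x \<notin> V \<longrightarrow> f x = 0)"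

lemma bump_inD:
  assumes "bump_in f V"
  shows "0 \<le> apply_bcontfun f x" "apply_bcontfun f x \<le> 1" "x \<notin> V \<Longrightarrow> apply_bcontfun f x = 0"
  using assms unfolding bump_in_def by auto

lemma bump_in_mono: "bump_in f V \<Longrightarrow> V \<subseteq> V' \<Longrightarrow> bump_in f V'"
  unfolding bump_in_def by blast

lemma norm_bump_in: "bump_in f V \<Longrightarrow> norm f \<le> 1"
  by (rule norm_bound) (simp add: bump_inD)

lemma exists_bump_in:
  fixes x :: "'a::t2_space"
  assumes "compact (UNIV :: 'a set)" and V: "open V" "x \<in> V"
  shows "\<exists>f W. bump_in f V \<and> open W \<and> x \<in> W \<and> (\<forall>z\<in>W. apply_bcontfun f z = 1)"
proof -
  have "normal_space (euclidean :: 'a topology)"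
  proof (rule compact_Hausdorff_or_regular_imp_normal_space)
    show "compact_space (euclidean :: 'a topology)" using assms(1) by (simp add: compact_space_def)
    have "Hausdorff_space (euclidean :: 'a topology)"
      unfolding Hausdorff_space_def disjnt_def using hausdorff by simp blast
    then show "Hausdorff_space (euclidean :: 'a topology) \<or> regular_space (euclidean :: 'a topology)" ..
  qed
  moreover have "closedin euclidean (- V)" "closedin euclidean {x}" "disjnt (- V) {x}"
    using V by (auto simp: disjnt_def)
  ultimately obtain g where g: "continuous_map euclidean (top_of_set {0..1::real}) g"
    "g ` (- V) \<subseteq> {0}" "g ` {x} \<subseteq> {1}" by (rule Urysohn_lemma[OF _ _ _ _ zero_le_one])
  have cont: "continuous_on UNIV g" and g01: "\<And>z. g z \<in> {0..1}"
    using g(1) by (auto simp: continuous_map_in_subtopology)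
  \<comment> \<open>Doubling and truncating a Urysohn function makes it equal to 1 on a whole
    neighbourhood of \<open>x\<close>.\<close>
  have "continuous_on UNIV (\<lambda>z. min 1 (2 * g z))" by (intro continuous_intros cont)
  moreover have "norm (min 1 (2 * g z)) \<le> 1" for z using g01[of z] by auto
  ultimately have "(\<lambda>z. min 1 (2 * g z)) \<in> bcontfun" by (rule bcontfun_normI)
  then obtain f where f: "(\<lambda>z. min 1 (2 * g z)) = apply_bcontfun f" by (rule bcontfunE)
  have "bump_in f V"
    unfolding bump_in_def f[symmetric] using g01 g(2) by (auto simp: image_subset_iff)
  moreover have "open {z. 1/2 < g z}" using cont by (intro open_Collect_less continuous_on_const)
  moreover have "\<forall>z\<in>{z. 1/2 < g z}. f z = 1" unfolding f[symmetric] by auto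
  moreover have "x \<in> {z. 1/2 < g z}" using g(3) by auto
  ultimately show ?thesis by blast
qed

text \<open>\<open>no_c0\<close> is the common consequence of the two alternatives for the Banach
  space: absence of copies of \<open>c0\<close>, or nontrivial cotype.\<close>

locale bounded_operator =
  fixes T :: "('a::t2_space \<Rightarrow>\<^sub>C real) \<Rightarrow> ('b::t2_space \<Rightarrow>\<^sub>C 'e::banach)" and b :: real
  assumes compact_dom: "compact (UNIV :: 'a set)" and compact_cod: "compact (UNIV :: 'b set)"
    and linear_T: "linear T" and b0: "0 \<le> b" and T_bound: "norm (T f) \<le> b * norm f"
    and no_c0: "0 < \<epsilon> \<Longrightarrow> bounded_combinations (e :: nat \<Rightarrow> 'e) UNIV B \<Longrightarrow> \<exists>i. norm (e i) < \<epsilon>"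
begin

lemma T_sum: "T (\<Sum>i\<in>F. a i *\<^sub>R f i) y = (\<Sum>i\<in>F. a i *\<^sub>R T (f i) y)"
  by (simp add: linear_sum[OF linear_T] linear_scale[OF linear_T] apply_bcontfun_sum)

lemma T_apply_bound: "norm f \<le> c \<Longrightarrow> norm (T f y) \<le> b * c"
  using norm_bounded[of "T f" y] T_bound[of f] mult_left_mono[OF _ b0, of "norm f" c] by linarith

lemma bounded_combinations_T:
  assumes \<kappa>: "\<And>x F. finite F \<Longrightarrow> F \<subseteq> I \<Longrightarrow> (\<Sum>i\<in>F. \<bar>apply_bcontfun (f i) x\<bar>) \<le> \<kappa>"
  shows "bounded_combinations (\<lambda>i. T (f i) y) I (b * \<kappa>)"
  unfolding bounded_combinations_def
proof (intro allI impI)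
  fix F and a :: "_ \<Rightarrow> real" assume F: "finite F" "F \<subseteq> I" and a: "\<forall>i\<in>F. \<bar>a i\<bar> \<le> 1"
  have "norm (\<Sum>i\<in>F. a i *\<^sub>R f i) \<le> \<kappa>"
  proof (rule norm_bound)
    fix x
    have "norm ((\<Sum>i\<in>F. a i *\<^sub>R f i) x) \<le> (\<Sum>i\<in>F. \<bar>a i * f i x\<bar>)"
      unfolding apply_bcontfun_sum by (simp add: sum_abs)
    also have "\<dots> \<le> (\<Sum>i\<in>F. \<bar>f i x\<bar>)"
      using a by (intro sum_mono) (simp add: abs_mult mult_left_le_one_le)
    also have "\<dots> \<le> \<kappa>" by (rule \<kappa>[OF F])
    finally show "norm ((\<Sum>i\<in>F. a i *\<^sub>R f i) x) \<le> \<kappa>" .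
  qed
  then show "norm (\<Sum>i\<in>F. a i *\<^sub>R T (f i) y) \<le> b * \<kappa>"
    unfolding T_sum[symmetric] by (rule T_apply_bound)
qed

text \<open>Infinitely many large values at one point would give a sequence bounded away from 0 with
  bounded combinations, contrary to \<open>no_c0\<close>.\<close>

lemma finite_large_values:
  assumes \<kappa>: "\<And>x F. finite F \<Longrightarrow> F \<subseteq> I \<Longrightarrow> (\<Sum>i\<in>F. \<bar>apply_bcontfun (f i) x\<bar>) \<le> \<kappa>" and "0 < \<epsilon>"
  shows "finite {i \<in> I. \<epsilon> \<le> norm (T (f i) y)}"
proof (rule ccontr)
  assume "infinite {i \<in> I. \<epsilon> \<le> norm (T (f i) y)}"
  then obtain h :: "nat \<Rightarrow> _" where h: "inj h" "range h \<subseteq> {i \<in> I. \<epsilon> \<le> norm (T (f i) y)}"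
    using infinite_countable_subset by blast
  have "bounded_combinations (\<lambda>n. T (f (h n)) y) UNIV (b * \<kappa>)"
  proof (rule bounded_combinations_T)
    fix x and F :: "nat set" assume "finite F"
    have "(\<Sum>n\<in>F. \<bar>f (h n) x\<bar>) = (\<Sum>i\<in>h ` F. \<bar>f i x\<bar>)"
      by (subst sum.reindex) (auto intro: inj_on_subset[OF h(1)])
    also have "\<dots> \<le> \<kappa>" using \<open>finite F\<close> h(2) by (intro \<kappa>) auto
    finally show "(\<Sum>n\<in>F. \<bar>f (h n) x\<bar>) \<le> \<kappa>" .
  qed
  then obtain n where "norm (T (f (h n)) y) < \<epsilon>" using no_c0[OF \<open>0 < \<epsilon>\<close>] by blast
  then show False using h(2) by (auto simp: image_subset_iff not_le[symmetric])
qed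

text \<open>\<open>D1\<close> acts on the domain side and \<open>D2\<close> on the other. Passing
  from a point of \<open>D1 A\<close> to an open set that merely meets \<open>A\<close> costs one
  derivative, and \<open>W\<close> leaves room for further bump functions inside.\<close>

definition vanishing :: "('a set \<Rightarrow> 'a set) \<Rightarrow> ('b set \<Rightarrow> 'b set) \<Rightarrow> bool" where
  "vanishing D1 D2 \<longleftrightarrow> (\<forall>L A x V \<epsilon>. closed L \<longrightarrow> D2 L = {} \<longrightarrow> x \<in> D1 A \<longrightarrow> open V \<longrightarrow> x \<in> V \<longrightarrow> 0 < \<epsilon> \<longrightarrow>
     (\<exists>f W. bump_in f V \<and> open W \<and> W \<inter> A \<noteq> {} \<and> (\<forall>z\<in>W. f z = 1) \<and> (\<forall>y\<in>L. norm (T f y) < \<epsilon>)))"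

text \<open>\<open>L\<close> is finite by compactness. Near \<open>x\<close> there are infinitely
  many disjointly supported bump functions, only finitely many of which are large at a given point,
  so some one is small on all of \<open>L\<close>.\<close>

lemma vanishing_accum_points: "vanishing accum_points accum_points"
  unfolding vanishing_def
proof (intro allI impI)
  fix L :: "'b set" and A :: "'a set" and x V and \<epsilon> :: real
  assume L: "closed L" "accum_points L = {}" and x: "x \<in> accum_points A" and V: "open V" "x \<in> V"
    and \<epsilon>: "0 < \<epsilon>"
  have "finite L"
  proof (rule ccontr)
    assume "infinite L"
    moreover have "compact L" using L compact_cod compact_Int_closed[of UNIV L] by simp
    ultimately obtain y where "y \<in> L" "y islimpt L"
      using Heine_Borel_imp_Bolzano_Weierstrass[of L L] by blast
    then show False using L by (auto simp: accum_points_def)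
  qed
  obtain U :: "nat \<Rightarrow> 'a set" where U: "\<And>j. open (U j)" "\<And>j. U j \<subseteq> V" "\<And>j. U j \<inter> A \<noteq> {}"
    "\<And>i j. i \<noteq> j \<Longrightarrow> U i \<inter> U j = {}"
    using islimpt_disjoint_open_sequence[OF _ V, of A] x unfolding accum_points_def by blast
  have "\<exists>f W. bump_in f (U j) \<and> open W \<and> W \<inter> A \<noteq> {} \<and> (\<forall>z\<in>W. apply_bcontfun f z = 1)" for j
  proof -
    obtain z where "z \<in> U j" "z \<in> A" using U(3) by blast
    then show ?thesis using exists_bump_in[OF compact_dom U(1) \<open>z \<in> U j\<close>] by blast
  qed
  then obtain f W where f: "\<And>j. bump_in (f j) (U j)" and W: "\<And>j. open (W j)" "\<And>j. W j \<inter> A \<noteq> {}"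
    "\<And>j z. z \<in> W j \<Longrightarrow> f j z = 1" by metis
  have "(\<Sum>i\<in>F. \<bar>f i x\<bar>) \<le> 1" if "finite F" for F x
  proof (cases "\<exists>i\<in>F. x \<in> U i")
    case True
    then obtain i where i: "i \<in> F" "x \<in> U i" by blast
    have "(\<Sum>i\<in>F. \<bar>f i x\<bar>) = \<bar>f i x\<bar> + (\<Sum>j\<in>F - {i}. \<bar>f j x\<bar>)"
      using that i by (intro sum.remove)
    also have "(\<Sum>j\<in>F - {i}. \<bar>f j x\<bar>) = 0"
      using U(4) i by (intro sum.neutral) (auto intro!: bump_inD[OF f])
    finally show ?thesis using bump_inD(1,2)[OF f[of i], of x] by simp
  next
    case False
    then have "(\<Sum>i\<in>F. \<bar>f i x\<bar>) = 0" by (intro sum.neutral) (auto intro!: bump_inD[OF f])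
    then show ?thesis by simp
  qed
  then have "finite {j \<in> UNIV. \<epsilon> \<le> norm (T (f j) y)}" for y
    using \<epsilon> by (intro finite_large_values) auto
  then have "finite (\<Union>y\<in>L. {j. \<epsilon> \<le> norm (T (f j) y)})" using \<open>finite L\<close> by simp
  then obtain j where "j \<notin> (\<Union>y\<in>L. {j. \<epsilon> \<le> norm (T (f j) y)})"
    using ex_new_if_finite[OF infinite_UNIV_nat] by blast
  then show "\<exists>f W. bump_in f V \<and> open W \<and> W \<inter> A \<noteq> {} \<and> (\<forall>z\<in>W. f z = 1) \<and> (\<forall>y\<in>L. norm (T f y) < \<epsilon>)"
    using bump_in_mono[OF f U(2)] W by (intro exI[of _ "f j"] exI[of _ "W j"]) (auto simp: not_le)
qed

definition large :: "real \<Rightarrow> (nat \<Rightarrow> 'a \<Rightarrow>\<^sub>C real) \<Rightarrow> nat \<Rightarrow> 'b \<Rightarrow> nat set" where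
  "large \<epsilon> g N y = {i. i \<le> N \<and> \<epsilon> \<le> norm (T (g i) y)}"

lemma finite_large: "finite (large \<epsilon> g N y)"
  unfolding large_def by simp

text \<open>Being large at least \<open>j\<close> times is a finite union of finite intersections of
  closed conditions.\<close>

lemma closed_large_card: "closed {y. j \<le> card (large \<epsilon> g N y)}"
proof -
  have "{y. j \<le> card (large \<epsilon> g N y)} =
      (\<Union>I\<in>{I. I \<subseteq> {..N} \<and> card I = j}. \<Inter>i\<in>I. {y. \<epsilon> \<le> norm (T (g i) y)})"
  proof (intro equalityI subsetI)
    fix y assume "y \<in> {y. j \<le> card (large \<epsilon> g N y)}"
    then obtain I where "I \<subseteq> large \<epsilon> g N y" "card I = j"
      using obtain_subset_with_card_n by (metis mem_Collect_eq)
    then show "y \<in> (\<Union>I\<in>{I. I \<subseteq> {..N} \<and> card I = j}. \<Inter>i\<in>I. {y. \<epsilon> \<le> norm (T (g i) y)})"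
      by (auto simp: large_def)
  next
    fix y assume "y \<in> (\<Union>I\<in>{I. I \<subseteq> {..N} \<and> card I = j}. \<Inter>i\<in>I. {y. \<epsilon> \<le> norm (T (g i) y)})"
    then obtain I where "I \<subseteq> large \<epsilon> g N y" "card I = j" by (auto simp: large_def)
    then show "y \<in> {y. j \<le> card (large \<epsilon> g N y)}" using card_mono[OF finite_large] by auto
  qed
  moreover have "closed {y. \<epsilon> \<le> norm (T (g i) y)}" for i
    by (intro closed_Collect_le continuous_intros) auto
  moreover have "finite {I. I \<subseteq> {..N} \<and> card I = j}" by (rule finite_subset[of _ "Pow {..N}"]) auto
  ultimately show ?thesis by (auto intro!: closed_UN closed_INT)
qed

definition nested :: "(nat \<Rightarrow> 'a \<Rightarrow>\<^sub>C real) \<Rightarrow> nat \<Rightarrow> 'a set \<Rightarrow> 'a set \<Rightarrow> bool" where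
  "nested g N V W \<longleftrightarrow> (\<forall>i\<le>N. bump_in (g i) V) \<and> (\<forall>i j z. i < j \<longrightarrow> j \<le> N \<longrightarrow> g j z \<noteq> 0 \<longrightarrow> g i z = 1) \<and>
     open W \<and> (\<forall>i\<le>N. \<forall>z\<in>W. g i z = 1)"

lemma nestedD:
  assumes "nested g N V W"
  shows "i \<le> N \<Longrightarrow> bump_in (g i) V" "i < j \<Longrightarrow> j \<le> N \<Longrightarrow> g j z \<noteq> 0 \<Longrightarrow> g i z = 1"
    "open W" "i \<le> N \<Longrightarrow> z \<in> W \<Longrightarrow> g i z = 1"
  using assms unfolding nested_def by blast+

text \<open>Each new function is chosen small on the points of \<open>(D2 ^^ p) L\<close> where already \<open>m - p\<close> of the
  previous ones are large; by the bound for \<open>Suc p\<close>, these points form a set with empty \<open>D2\<close>.\<close>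

lemma nested_sequence:
  assumes P: "vanishing D1 D2" and D: "derivation_op D2" and "x \<in> (D1 ^^ N) A"
    and V: "open V" "x \<in> V" and \<epsilon>: "0 < \<epsilon>" and L: "closed L"
    and small: "\<And>f y. bump_in f V \<Longrightarrow> y \<in> (D2 ^^ m) L \<Longrightarrow> norm (T f y) < \<epsilon>"
  shows "\<exists>g W. nested g N V W \<and> W \<inter> A \<noteq> {} \<and>
    (\<forall>p\<le>m. \<forall>y\<in>(D2 ^^ p) L. card (large \<epsilon> g N y) \<le> m - p)"
  using assms(3)
proof (induction N arbitrary: A)
  case 0
  obtain f W where f: "bump_in f V" "open W" "x \<in> W" "\<forall>z\<in>W. apply_bcontfun f z = 1"
    using exists_bump_in[OF compact_dom V] by blast
  have "card (large \<epsilon> (\<lambda>_. f) 0 y) \<le> m - p" if "p \<le> m" "y \<in> (D2 ^^ p) L" for p y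
  proof (cases "p = m")
    case True
    then have "large \<epsilon> (\<lambda>_. f) 0 y = {}" using small[OF f(1), of y] that by (auto simp: large_def)
    then show ?thesis by simp
  next
    case False
    have "large \<epsilon> (\<lambda>_. f) 0 y \<subseteq> {0}" by (auto simp: large_def)
    then have "card (large \<epsilon> (\<lambda>_. f) 0 y) \<le> card {0::nat}" by (intro card_mono) auto
    then show ?thesis using False that by simp
  qed
  moreover have "nested (\<lambda>_. f) 0 V W" using f by (auto simp: nested_def)
  ultimately show ?case using f 0 by (intro exI[of _ "\<lambda>_. f"] exI[of _ W]) auto
next
  case (Suc N)
  note pow = derivation_op_funpow[OF D]
  \<comment> \<open>The induction hypothesis is applied to \<open>D1 A\<close>, which saves one
    derivative for placing the next function.\<close>
  from Suc.prems have "x \<in> (D1 ^^ N) (D1 A)" by (simp add: funpow_swap1)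
  from Suc.IH[OF this] obtain g W where g: "nested g N V W" and "W \<inter> D1 A \<noteq> {}"
    and card: "\<And>p y. p \<le> m \<Longrightarrow> y \<in> (D2 ^^ p) L \<Longrightarrow> card (large \<epsilon> g N y) \<le> m - p" by blast
  then obtain x' where x': "x' \<in> D1 A" "x' \<in> W" by blast
  define B where "B p = (D2 ^^ p) L \<inter> {y. m - p \<le> card (large \<epsilon> g N y)}" for p
  have closed_B: "closed (B p)" for p
    unfolding B_def by (intro closed_Int closed_large_card derivation_op_closed[OF pow] L)
  have "D2 (B p) = {}" if "p < m" for p
  proof -
    have "D2 (B p) \<subseteq> (D2 ^^ Suc p) L"
      using derivation_op_mono[OF D, of "B p" "(D2 ^^ p) L"] by (simp add: B_def)
    moreover have "D2 (B p) \<subseteq> {y. m - p \<le> card (large \<epsilon> g N y)}"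
      using derivation_op_subset[OF D, of "B p"] by (auto simp: B_def)
    moreover have "\<not> m - p \<le> card (large \<epsilon> g N y)" if "y \<in> (D2 ^^ Suc p) L" for y
      using card[of "Suc p" y] that \<open>p < m\<close> by simp
    ultimately show ?thesis by blast
  qed
  then have "D2 (\<Union>p\<in>{..<m}. B p) = {}" by (intro derivation_op_UN[OF D] closed_B) auto
  moreover have "closed (\<Union>p\<in>{..<m}. B p)" using closed_B by (intro closed_UN) auto
  ultimately obtain f W' where f: "bump_in f W" "open W'" "W' \<inter> A \<noteq> {}" "\<And>z. z \<in> W' \<Longrightarrow> f z = 1"
    and fB: "\<And>y. y \<in> (\<Union>p\<in>{..<m}. B p) \<Longrightarrow> norm (T f y) < \<epsilon>"
    using P x' nestedD(3)[OF g] \<epsilon> unfolding vanishing_def by metis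
  have WV: "W \<subseteq> V"
  proof
    fix z assume "z \<in> W"
    then have "g 0 z = 1" using nestedD(4)[OF g] by simp
    then show "z \<in> V" using bump_inD(3)[OF nestedD(1)[OF g, of 0], of z] by force
  qed
  have W'W: "W' \<subseteq> W" using f(4) bump_inD(3)[OF f(1)] by force
  let ?g = "g(Suc N := f)"
  have "nested ?g (Suc N) V W'"
    unfolding nested_def
  proof (intro conjI allI impI ballI)
    fix i assume "i \<le> Suc N"
    then show "bump_in (?g i) V" using nestedD(1)[OF g] bump_in_mono[OF f(1) WV] by auto
    show "apply_bcontfun (?g i) z = 1" if "z \<in> W'" for z
      using nestedD(4)[OF g] f(4)[OF that] W'W that \<open>i \<le> Suc N\<close> by auto
  next
    fix i j z assume ij: "i < j" "j \<le> Suc N" "apply_bcontfun (?g j) z \<noteq> 0"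
    show "apply_bcontfun (?g i) z = 1"
    proof (cases "j = Suc N")
      case True
      then have "z \<in> W" using ij bump_inD(3)[OF f(1), of z] by auto
      then show ?thesis using nestedD(4)[OF g] ij True by simp
    next
      case False
      then show ?thesis using nestedD(2)[OF g, of i j z] ij by simp
    qed
  qed (rule f(2))
  moreover have "card (large \<epsilon> ?g (Suc N) y) \<le> m - p" if p: "p \<le> m" "y \<in> (D2 ^^ p) L" for p y
  proof -
    have large: "large \<epsilon> ?g (Suc N) y = (if \<epsilon> \<le> norm (T f y) then insert (Suc N) (large \<epsilon> g N y) else large \<epsilon> g N y)"
      by (auto simp: large_def le_Suc_eq)
    show ?thesis
    \<comment> \<open>If \<open>f\<close> is large at \<open>y\<close>, then \<open>p = m\<close> is
      excluded by \<open>small\<close>, and for smaller \<open>p\<close> the point avoids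
      \<open>B p\<close>, so the old count leaves room for one more.\<close>
    proof (cases "\<epsilon> \<le> norm (T f y)")
      case True
      have fV: "bump_in f V" using bump_in_mono[OF f(1) WV] .
      have "p \<noteq> m" using small[OF fV] True p by force
      then have "y \<notin> B p" using fB[of y] True p by fastforce
      then have "card (large \<epsilon> g N y) < m - p" using p by (simp add: B_def)
      then show ?thesis using True finite_large by (simp add: large card_insert_if)
    next
      case False
      then show ?thesis using card[OF p] by (simp add: large)
    qed
  qed
  ultimately show ?case using f(3) by blast
qed

text \<open>For nonempty \<open>S\<close>, compactness gives a smaller exponent \<open>c\<close> for
  which \<open>m\<close> iterations exhaust \<open>L\<close>. Nested sequences for \<open>c\<close>
  can be arbitrarily long, while at most \<open>m\<close> members are large at any point of
  \<open>L\<close>, so their average is small there.\<close>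

lemma vanishing_omega_step:
  assumes r: "Well_order r" and S: "S \<subseteq> Field r"
    and IH: "\<And>c. c \<in> S \<Longrightarrow> vanishing (omega_deriv r c) (omega_deriv r c)"
  shows "vanishing (omega_step (omega_deriv r) S) (omega_step (omega_deriv r) S)"
proof (cases "S = {}")
  case True
  then show ?thesis using vanishing_accum_points by (simp add: vanishing_def omega_step_def)
next
  case ne: False
  show ?thesis
    unfolding vanishing_def
  proof (intro allI impI)
    fix L :: "'b set" and A :: "'a set" and x V and \<epsilon> :: real
    assume L: "closed L" "omega_step (omega_deriv r) S L = {}" and x: "x \<in> omega_step (omega_deriv r) S A"
      and V: "open V" "x \<in> V" and \<epsilon>: "0 < \<epsilon>"
    have "compact L" using L compact_cod compact_Int_closed[of UNIV L] by simp
    then obtain c m where c: "c \<in> S" and m: "(omega_deriv r c ^^ m) L = {}"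
      using omega_step_empty[OF r S ne _ L(2)] by blast
    \<comment> \<open>\<open>N\<close> is so large that the at most \<open>m\<close> large values,
      each bounded by \<open>b\<close>, contribute less than half of the permitted total.\<close>
    obtain N :: nat where "real m * b / (\<epsilon> / 2) < real N" using reals_Archimedean2 by blast
    then have N: "real m * b < real (Suc N) * (\<epsilon> / 2)" using \<epsilon> by (simp add: field_simps)
    have "x \<in> (omega_deriv r c ^^ N) A" using x c ne by (simp add: omega_step_def)
    from nested_sequence[OF IH[OF c] derivation_op_omega_deriv[OF r] this V half_gt_zero[OF \<epsilon>] L(1), of m]
    obtain g W where g: "nested g N V W" and W: "W \<inter> A \<noteq> {}"
      and card: "\<And>p y. p \<le> m \<Longrightarrow> y \<in> (omega_deriv r c ^^ p) L \<Longrightarrow> card (large (\<epsilon> / 2) g N y) \<le> m - p"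
      unfolding m by blast
    define f where "f = (\<Sum>i\<in>{..N}. (1 / real (Suc N)) *\<^sub>R g i)"
    have f: "f z = (\<Sum>i\<le>N. g i z) / real (Suc N)" for z
      by (simp add: f_def apply_bcontfun_sum sum_divide_distrib)
    have "bump_in f V"
      unfolding bump_in_def
    proof (intro conjI allI impI)
      fix z
      show "0 \<le> f z" unfolding f using bump_inD(1)[OF nestedD(1)[OF g]] by (intro divide_nonneg_nonneg sum_nonneg) auto
      have "(\<Sum>i\<le>N. g i z) \<le> (\<Sum>i\<le>N. 1)" using bump_inD(2)[OF nestedD(1)[OF g]] by (intro sum_mono) auto
      then show "f z \<le> 1" unfolding f by (simp add: field_simps)
      assume "z \<notin> V"
      then show "f z = 0" unfolding f using bump_inD(3)[OF nestedD(1)[OF g]] by simp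
    qed
    moreover have "f z = 1" if "z \<in> W" for z unfolding f using nestedD(4)[OF g _ that] by simp
    moreover have "norm (T f y) < \<epsilon>" if "y \<in> L" for y
    proof -
      have "norm (T (g i) y) \<le> (if i \<in> large (\<epsilon> / 2) g N y then b else 0) + \<epsilon> / 2" if "i \<le> N" for i
        using T_apply_bound[OF norm_bump_in[OF nestedD(1)[OF g that]], of y] that \<epsilon>
        by (auto simp: large_def)
      then have "(\<Sum>i\<le>N. norm (T (g i) y)) \<le>
          (\<Sum>i\<le>N. (if i \<in> large (\<epsilon> / 2) g N y then b else 0) + \<epsilon> / 2)" by (intro sum_mono) simp
      also have "\<dots> = real (card (large (\<epsilon> / 2) g N y)) * b + real (Suc N) * (\<epsilon> / 2)"
      proof -
        have "(\<Sum>i\<le>N. if i \<in> large (\<epsilon> / 2) g N y then b else 0) = (\<Sum>i\<in>large (\<epsilon> / 2) g N y. b)"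
          by (subst sum.inter_restrict[symmetric]) (auto simp: large_def intro!: arg_cong[where f = card])
        then show ?thesis by (simp add: sum.distrib)
      qed
      also have "\<dots> \<le> real m * b + real (Suc N) * (\<epsilon> / 2)"
        using card[of 0 y] that b0 by (simp add: mult_right_mono)
      also have "\<dots> < real (Suc N) * \<epsilon>" using N by simp
      finally have "(\<Sum>i\<le>N. norm (T (g i) y)) < real (Suc N) * \<epsilon>" .
      moreover have "norm (T f y) \<le> (\<Sum>i\<le>N. norm (T (g i) y)) / real (Suc N)"
      proof -
        have "norm (T f y) \<le> (\<Sum>i\<le>N. norm ((1 / real (Suc N)) *\<^sub>R T (g i) y))"
          unfolding f_def T_sum by (rule norm_sum)
        then show ?thesis by (simp add: sum_divide_distrib)
      qed
      moreover from calculation(1) have "(\<Sum>i\<le>N. norm (T (g i) y)) / real (Suc N) < \<epsilon>"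
        by (subst pos_divide_less_eq) (simp_all add: mult.commute)
      ultimately show ?thesis by linarith
    qed
    ultimately show "\<exists>f W. bump_in f V \<and> open W \<and> W \<inter> A \<noteq> {} \<and> (\<forall>z\<in>W. f z = 1) \<and> (\<forall>y\<in>L. norm (T f y) < \<epsilon>)"
      using W nestedD(3)[OF g] by blast
  qed
qed

lemma vanishing_omega_deriv:
  assumes r: "Well_order r"
  shows "vanishing (omega_deriv r a) (omega_deriv r a)"
proof (rule wo_rel.well_order_induct[OF wo_rel.intro[OF r], of _ a])
  fix a assume IH: "\<forall>c. c \<noteq> a \<and> (c, a) \<in> r \<longrightarrow> vanishing (omega_deriv r c) (omega_deriv r c)"
  have "vanishing (omega_step (omega_deriv r) (underS r a)) (omega_step (omega_deriv r) (underS r a))"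
    by (rule vanishing_omega_step[OF r]) (use IH in \<open>auto simp: underS_def Field_def\<close>)
  then show "vanishing (omega_deriv r a) (omega_deriv r a)"
    unfolding vanishing_def omega_deriv_unfold[OF r, of a] .
qed

end

section \<open>Combinations of nested functions\<close>

text \<open>Nested functions take values 1, ..., 1, s, 0, ..., 0 at a point, so beyond the first
  index the combination is a convex combination of two consecutive partial sums of
  \<open>d\<close>.\<close>

lemma abs_nested_sum_le:
  fixes d t :: "nat \<Rightarrow> real"
  assumes t: "\<And>i. i \<le> n \<Longrightarrow> 0 \<le> t i" "\<And>i. i \<le> n \<Longrightarrow> t i \<le> 1"
    and nest: "\<And>i j. i < j \<Longrightarrow> j \<le> n \<Longrightarrow> t j \<noteq> 0 \<Longrightarrow> t i = 1"
    and d: "\<And>j. j \<le> n \<Longrightarrow> \<bar>\<Sum>i\<le>j. d i\<bar> \<le> \<kappa>"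
  shows "\<bar>\<Sum>i\<le>n. d i * t i\<bar> \<le> \<kappa>"
  using assms
proof (induction n)
  case 0
  have "\<bar>d 0\<bar> * \<bar>t 0\<bar> \<le> \<bar>d 0\<bar>" using 0(1)[of 0] 0(2)[of 0] by (intro mult_right_le_one_le) auto
  then show ?case using 0(4)[of 0] by (simp add: abs_mult)
next
  case (Suc n)
  show ?case
  proof (cases "t (Suc n) = 0")
    case True
    then show ?thesis using Suc.IH Suc.prems by simp
  next
    case False
    let ?s = "t (Suc n)" and ?S = "\<lambda>j. \<Sum>i\<le>j. d i"
    have "t i = 1" if "i \<le> n" for i using Suc.prems(3)[of i "Suc n"] that False by simp
    then have "(\<Sum>i\<le>Suc n. d i * t i) = (1 - ?s) * ?S n + ?s * ?S (Suc n)"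
      by (simp add: algebra_simps)
    also have "\<bar>\<dots>\<bar> \<le> \<bar>(1 - ?s) * ?S n\<bar> + \<bar>?s * ?S (Suc n)\<bar>" by (rule abs_triangle_ineq)
    also have "\<dots> = (1 - ?s) * \<bar>?S n\<bar> + ?s * \<bar>?S (Suc n)\<bar>"
      using Suc.prems(1,2)[of "Suc n"] by (simp add: abs_mult)
    also have "\<dots> \<le> (1 - ?s) * \<kappa> + ?s * \<kappa>"
      using Suc.prems(1,2)[of "Suc n"] Suc.prems(4)[of n] Suc.prems(4)[of "Suc n"]
      by (intro add_mono mult_left_mono) auto
    finally show ?thesis by (simp add: algebra_simps)
  qed
qed

text \<open>\<open>c\<close> are the coefficients of a combination of nested functions, \<open>I\<close> the indices of those
  whose images are large at a given point: only there the coefficients may not be changed. A bound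
  for the partial sums is a bound for the norm of the modified combination.\<close>

definition adjustable :: "(nat \<Rightarrow> real) \<Rightarrow> nat \<Rightarrow> nat \<Rightarrow> real \<Rightarrow> bool" where
  "adjustable c n k \<kappa> \<longleftrightarrow> (\<forall>I\<subseteq>{..n}. card I \<le> k \<longrightarrow>
     (\<exists>d. (\<forall>i\<in>I. d i = c i) \<and> (\<forall>i\<le>n. \<bar>c i - d i\<bar> \<le> 3) \<and> (\<forall>j\<le>n. \<bar>\<Sum>i\<le>j. d i\<bar> \<le> \<kappa>)))"

lemma sum_indicator_atMost: "(\<Sum>i\<le>(j::nat). if i \<in> I then 1 else 0 :: real) = real (card (I \<inter> {..j}))"
  by (simp add: sum.inter_restrict[symmetric] Int_commute)

lemma sum_less_atMost: "(\<Sum>i\<le>(j::nat). if i < k then 1 else 0 :: real) = real (min (Suc j) k)"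
proof -
  have "(\<Sum>i\<le>j. if i < k then 1 else 0 :: real) = real (card ({..<k} \<inter> {..j}))"
    using sum_indicator_atMost[of "{..<k}" j] by simp
  also have "{..<k} \<inter> {..j} = {..<min (Suc j) k}" by auto
  finally show ?thesis by simp
qed

text \<open>Lowering each coefficient outside \<open>I\<close> by 2 leaves the partial sum
  \<open>2 * card (I \<inter> {..j}) - min (Suc j) k\<close>. It is at most \<open>k\<close> in
  modulus because the cardinality is at most both \<open>k\<close> and \<open>Suc j\<close>.\<close>

lemma adjustable_ones_twos: "adjustable (\<lambda>i. if i < k then 1 else 2) n k (real k)"
  unfolding adjustable_def
proof (intro allI impI)
  fix I assume I: "I \<subseteq> {..n}" "card I \<le> k"
  define d :: "nat \<Rightarrow> real" where "d i = 2 * (if i \<in> I then 1 else 0) - (if i < k then 1 else 0)" for i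
  have S: "(\<Sum>i\<le>j. d i) = 2 * real (card (I \<inter> {..j})) - real (min (Suc j) k)" for j
    unfolding d_def by (simp only: sum_subtractf sum_distrib_left[symmetric] sum_indicator_atMost sum_less_atMost)
  have "finite I" using I(1) finite_subset by blast
  have "\<bar>\<Sum>i\<le>j. d i\<bar> \<le> real k" for j
  proof -
    have "card (I \<inter> {..j}) \<le> card I" using \<open>finite I\<close> by (intro card_mono) auto
    moreover have "card (I \<inter> {..j}) \<le> card {..j}" by (intro card_mono) auto
    ultimately show ?thesis using I(2) unfolding S by (auto simp: min_def)
  qed
  then show "\<exists>d. (\<forall>i\<in>I. d i = (if i < k then 1 else 2)) \<and>
      (\<forall>i\<le>n. \<bar>(if i < k then 1 else 2) - d i\<bar> \<le> 3) \<and> (\<forall>j\<le>n. \<bar>\<Sum>i\<le>j. d i\<bar> \<le> real k)"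
    by (intro exI[of _ d]) (auto simp: d_def)
qed

text \<open>As \<open>card I \<le> k\<close> and \<open>k \<le> n\<close>, some index
  \<open>i0\<close> is outside \<open>I\<close>. Subtracting 2 there turns the partial sums into 1
  before \<open>i0\<close>, -1 from \<open>i0\<close> until \<open>n\<close>, and 1 at
  \<open>n\<close>.\<close>

lemma adjustable_three:
  assumes "1 \<le> k" "k \<le> n"
  shows "adjustable (\<lambda>i. (if i = 0 then 1 else 0) + (if i = n then 2 else 0)) n k 1"
  unfolding adjustable_def
proof (intro allI impI)
  fix I assume I: "I \<subseteq> {..n}" "card I \<le> k"
  have "I \<noteq> {..n}" using I(2) assms by auto
  then obtain i0 where i0: "i0 \<le> n" "i0 \<notin> I" using I(1) by auto
  define d :: "nat \<Rightarrow> real" where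
    "d i = (if i = 0 then 1 else 0) + (if i = n then 2 else 0) - (if i = i0 then 2 else 0)" for i
  have "(\<Sum>i\<le>j. d i) = 1 + (if n \<le> j then 2 else 0) - (if i0 \<le> j then 2 else 0)" for j
    unfolding d_def by (simp add: sum.distrib sum_subtractf)
  then have "\<bar>\<Sum>i\<le>j. d i\<bar> \<le> 1" if "j \<le> n" for j using that i0 by auto
  then show "\<exists>d. (\<forall>i\<in>I. d i = (if i = 0 then 1 else 0) + (if i = n then 2 else 0 :: real)) \<and>
      (\<forall>i\<le>n. \<bar>(if i = 0 then 1 else 0) + (if i = n then 2 else 0) - d i\<bar> \<le> 3) \<and>
      (\<forall>j\<le>n. \<bar>\<Sum>i\<le>j. d i\<bar> \<le> 1)"
    using i0 by (intro exI[of _ d]) (auto simp: d_def)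
qed

lemma sum_ones_twos:
  assumes "k \<le> n"
  shows "(\<Sum>i\<le>n. if i < k then 1 else 2 :: real) = 2 * real n + 2 - real k"
proof -
  have "(\<Sum>i\<le>n. if i < k then 1 else 2 :: real) = (\<Sum>i\<le>n. 2 - (if i < k then 1 else 0))"
    by (intro sum.cong) auto
  also have "\<dots> = (\<Sum>i\<le>n. 2) - (\<Sum>i\<le>n. if i < k then 1 else 0 :: real)" by (rule sum_subtractf)
  finally show ?thesis using assms unfolding sum_less_atMost by (simp add: min_def)
qed

context bounded_operator
begin

text \<open>The combination \<open>u\<close> takes the value of the full coefficient sum on
  \<open>W\<close>. At each \<open>y\<close> its image differs from that of an adjusted combination,
  chosen for this \<open>y\<close>, only by terms that are not large there.\<close>

lemma nested_lower_bound:
  assumes a: "0 \<le> a" "\<And>f. norm f \<le> a * norm (T f)" and g: "nested g n V W" and W: "W \<noteq> {}"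
    and \<epsilon>: "0 \<le> \<epsilon>" and card: "\<And>y. card (large \<epsilon> g n y) \<le> k" and c: "adjustable c n k \<kappa>"
  shows "(\<Sum>i\<le>n. c i) \<le> a * (b * \<kappa> + 3 * real (Suc n) * \<epsilon>)"
proof -
  define u where "u = (\<Sum>i\<in>{..n}. c i *\<^sub>R g i)"
  obtain z where "z \<in> W" using W by blast
  then have "apply_bcontfun u z = (\<Sum>i\<le>n. c i)"
    using nestedD(4)[OF g] by (simp add: u_def apply_bcontfun_sum)
  then have "(\<Sum>i\<le>n. c i) \<le> norm u" using norm_bounded[of u z] by simp
  also have "\<dots> \<le> a * norm (T u)" by (rule a(2))
  also have "norm (T u) \<le> b * \<kappa> + 3 * real (Suc n) * \<epsilon>"
  proof (rule norm_bound)
    fix y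
    obtain d where d: "\<And>i. i \<in> large \<epsilon> g n y \<Longrightarrow> d i = c i" "\<And>i. i \<le> n \<Longrightarrow> \<bar>c i - d i\<bar> \<le> 3"
      "\<And>j. j \<le> n \<Longrightarrow> \<bar>\<Sum>i\<le>j. d i\<bar> \<le> \<kappa>"
      using c card[of y] unfolding adjustable_def
      by (metis (no_types, lifting) atMost_iff large_def mem_Collect_eq subsetI)
    have "norm (\<Sum>i\<in>{..n}. d i *\<^sub>R g i) \<le> \<kappa>"
    proof (rule norm_bound)
      fix x
      have "\<bar>\<Sum>i\<le>n. d i * g i x\<bar> \<le> \<kappa>"
        using d(3) nestedD(1,2)[OF g] by (intro abs_nested_sum_le) (auto intro: bump_inD)
      then show "norm ((\<Sum>i\<in>{..n}. d i *\<^sub>R g i) x) \<le> \<kappa>" by (simp add: apply_bcontfun_sum)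
    qed
    then have 1: "norm (\<Sum>i\<in>{..n}. d i *\<^sub>R T (g i) y) \<le> b * \<kappa>"
      unfolding T_sum[symmetric] by (rule T_apply_bound)
    have 2: "norm (\<Sum>i\<in>{..n}. (c i - d i) *\<^sub>R T (g i) y) \<le> (\<Sum>i\<in>{..n}. 3 * \<epsilon>)"
    proof (rule sum_norm_le)
      fix i assume i: "i \<in> {..n}"
      show "norm ((c i - d i) *\<^sub>R T (g i) y) \<le> 3 * \<epsilon>"
      proof (cases "i \<in> large \<epsilon> g n y")
        case True
        then show ?thesis using d(1) \<epsilon> by simp
      next
        case False
        then have "norm (T (g i) y) \<le> \<epsilon>" using i by (simp add: large_def)
        then show ?thesis using d(2)[of i] i \<epsilon> by (simp add: mult_mono)
      qed
    qed
    have "T u y = (\<Sum>i\<in>{..n}. d i *\<^sub>R T (g i) y) + (\<Sum>i\<in>{..n}. (c i - d i) *\<^sub>R T (g i) y)"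
      unfolding u_def T_sum by (simp add: sum.distrib[symmetric] scaleR_diff_left)
    then have "norm (T u y) \<le> b * \<kappa> + (\<Sum>i\<in>{..n}. 3 * \<epsilon>)"
      using norm_triangle_mono[OF 1 2] by simp
    then show "norm (T u y) \<le> b * \<kappa> + 3 * real (Suc n) * \<epsilon>" by (simp add: algebra_simps)
  qed
  finally show ?thesis using a(1) by (simp add: mult_left_mono)
qed

text \<open>If no bump function in \<open>U\<close> were large on the \<open>k\<close>-th
  derivative, \<open>nested_sequence\<close> with \<open>L = UNIV\<close> would give a sequence with
  at most \<open>k\<close> large members everywhere, contradicting \<open>nested_lower_bound\<close>
  for small \<epsilon>.\<close>

lemma large_values_on_derivative:
  assumes a: "0 \<le> a" "\<And>f. norm f \<le> a * norm (T f)"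
    and D: "vanishing D1 D2" "derivation_op D2"
    and c: "adjustable c n k \<kappa>" "a * (b * \<kappa>) < (\<Sum>i\<le>n. c i)"
  shows "\<exists>\<epsilon>>0. \<forall>U. open U \<longrightarrow> (D1 ^^ n) UNIV \<inter> U \<noteq> {} \<longrightarrow>
    (\<exists>f. bump_in f U \<and> (\<exists>y\<in>(D2 ^^ k) UNIV. \<epsilon> \<le> norm (T f y)))"
proof -
  define \<delta> where "\<delta> = (\<Sum>i\<le>n. c i) - a * (b * \<kappa>)"
  \<comment> \<open>With \<open>a + 1\<close> in the divisor, the error term is
    \<open>a / (a + 1)\<close> times \<delta>, strictly less than \<delta> even if
    \<open>a = 0\<close>.\<close>
  define \<epsilon> where "\<epsilon> = \<delta> / (3 * real (Suc n) * (a + 1))"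
  have \<delta>: "0 < \<delta>" using c(2) by (simp add: \<delta>_def)
  then have \<epsilon>: "0 < \<epsilon>" using a(1) by (simp add: \<epsilon>_def)
  have eq: "3 * real (Suc n) * \<epsilon> = \<delta> / (a + 1)" by (simp add: \<epsilon>_def)
  have "a * (3 * real (Suc n) * \<epsilon>) < \<delta>"
    unfolding eq using \<delta> a(1) by (simp add: field_simps)
  then have lt: "a * (b * \<kappa> + 3 * real (Suc n) * \<epsilon>) < (\<Sum>i\<le>n. c i)"
    unfolding \<delta>_def by (simp add: distrib_left)
  have "\<exists>f. bump_in f U \<and> (\<exists>y\<in>(D2 ^^ k) UNIV. \<epsilon> \<le> norm (T f y))"
    if U: "open U" "(D1 ^^ n) UNIV \<inter> U \<noteq> {}" for U
  proof (rule ccontr)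
    assume none: "\<not> ?thesis"
    obtain x where x: "x \<in> (D1 ^^ n) UNIV" "x \<in> U" using U(2) by blast
    have "norm (T f y) < \<epsilon>" if "bump_in f U" "y \<in> (D2 ^^ k) UNIV" for f y
      by (rule ccontr) (use none that in \<open>auto simp: not_less\<close>)
    from nested_sequence[OF D x(1) U(1) x(2) \<epsilon> closed_UNIV this]
    obtain g W where g: "nested g n U W" "W \<noteq> {}"
      and "\<And>p y. p \<le> k \<Longrightarrow> y \<in> (D2 ^^ p) UNIV \<Longrightarrow> card (large \<epsilon> g n y) \<le> k - p" by blast
    then have "card (large \<epsilon> g n y) \<le> k" for y by (metis UNIV_I diff_zero funpow_0 le0)
    from nested_lower_bound[OF a g less_imp_le[OF \<epsilon>] this c(1)] show False using lt by simp
  qed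
  then show ?thesis using \<epsilon> by blast
qed

end

section \<open>Transfer of open families and comparison of cardinals\<close>

lemma card_of_finite_fibres:
  assumes "infinite C" and "|h ` X| \<le>o |C|" and "\<And>y. finite {x \<in> X. h x = y}"
  shows "|X| \<le>o |C|"
proof -
  have "|{x \<in> X. h x = y}| \<le>o |C|" for y
    using assms(1,3) by (intro ordLess_imp_ordLeq finite_ordLess_infinite card_of_Well_order)
      (simp_all add: Field_card_of)
  then have "|\<Union>y\<in>h ` X. {x \<in> X. h x = y}| \<le>o |C|"
    using assms(1,2) by (intro card_of_UNION_ordLeq_infinite) auto
  moreover have "(\<Union>y\<in>h ` X. {x \<in> X. h x = y}) = X" by auto
  ultimately show ?thesis by simp
qed

text \<open>Families are unindexed, so distinct members may have the same image \<open>V\<close>;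
  all of them contribute at any chosen point of \<open>V\<close>, hence they are finitely
  many.\<close>

lemma finite_fibre:
  assumes "\<And>y. finite {U \<in> \<U>. y \<in> h U}" "nonempty_open_family (h ` \<U>)"
  shows "finite {U \<in> \<U>. h U = V}"
proof (cases "V \<in> h ` \<U>")
  case True
  then obtain y where "y \<in> V" using assms(2) by (auto simp: nonempty_open_family_def)
  then show ?thesis by (intro finite_subset[OF _ assms(1)[of y]]) auto
next
  case False
  then have "{U \<in> \<U>. h U = V} = {}" by auto
  then show ?thesis by (simp only: finite.emptyI)
qed

text \<open>This makes the cardinal on the target side infinite, so that finite fibres do not affect
  the comparison.\<close>

lemma infinite_disjoint_open_family:
  fixes A :: "'a::t2_space set"
  assumes "compact (UNIV :: 'a set)" "infinite A"
  shows "\<exists>\<U>. infinite \<U> \<and> nonempty_open_family \<U> \<and> point_bounded \<U> \<and> meeting \<U> A"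
proof -
  obtain x where "x islimpt A"
    using Heine_Borel_imp_Bolzano_Weierstrass[OF assms] by blast
  then obtain U :: "nat \<Rightarrow> 'a set" where U: "\<And>j. open (U j)" "\<And>j. U j \<inter> A \<noteq> {}"
    "\<And>i j. i \<noteq> j \<Longrightarrow> U i \<inter> U j = {}"
    using islimpt_disjoint_open_sequence[of x A UNIV] by auto
  have "inj U"
  proof (rule injI, rule ccontr)
    fix i j assume "U i = U j" "i \<noteq> j"
    then show False using U(2)[of i] U(3)[of i j] by simp
  qed
  have "finite {V \<in> range U. x \<in> V} \<and> card {V \<in> range U. x \<in> V} \<le> 1" for x
  proof (cases "\<exists>i. x \<in> U i")
    case True
    then obtain i where "x \<in> U i" by (rule exE)
    have "V = U i" if V: "V \<in> range U" "x \<in> V" for V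
    proof -
      obtain j where j: "V = U j" using V(1) by blast
      have "i = j" by (rule ccontr) (use U(3)[of i j] \<open>x \<in> U i\<close> V(2) j in auto)
      then show ?thesis using j by simp
    qed
    then have sub: "{V \<in> range U. x \<in> V} \<subseteq> {U i}" by blast
    show ?thesis using finite_subset[OF sub] card_mono[OF _ sub] by simp
  next
    case False
    then have none: "{V \<in> range U. x \<in> V} = {}" by auto
    show ?thesis unfolding none by simp
  qed
  then have "point_bounded (range U)" unfolding point_bounded_def has_order_def by blast
  moreover have "infinite (range U)" by (rule range_inj_infinite[OF \<open>inj U\<close>])
  ultimately show ?thesis
    using U(1,2) by (intro exI[of _ "range U"]) (auto simp: nonempty_open_family_def meeting_def)
qed

context bounded_operator
begin

text \<open>At most \<kappa> of the functions \<open>f U\<close> are nonzero at a point, which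
  bounds their combinations and hence those of their images; point-finiteness follows from
  \<open>finite_large_values\<close>.\<close>

lemma bounded_family_transfer:
  assumes \<epsilon>: "0 < \<epsilon>"
    and large: "\<And>U. open U \<Longrightarrow> A \<inter> U \<noteq> {} \<Longrightarrow> \<exists>f. bump_in f U \<and> (\<exists>y\<in>B. \<epsilon> \<le> norm (T f y))"
    and \<U>: "nonempty_open_family \<U>" "has_order \<U> \<kappa>" "meeting \<U> A"
  shows "\<exists>f h. nonempty_open_family (h ` \<U>) \<and> meeting (h ` \<U>) B \<and>
    (\<forall>y. finite {U \<in> \<U>. y \<in> h U}) \<and> (\<forall>U\<in>\<U>. \<forall>y\<in>h U. \<epsilon> / 2 \<le> norm (T (f U) y)) \<and>
    (\<forall>y. bounded_combinations (\<lambda>U. T (f U) y) \<U> (b * real \<kappa>))"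
proof -
  have "\<exists>f. bump_in f U \<and> (\<exists>y\<in>B. \<epsilon> \<le> norm (T f y))" if "U \<in> \<U>" for U
    using that \<U> large unfolding nonempty_open_family_def meeting_def by blast
  then obtain f where f: "\<And>U. U \<in> \<U> \<Longrightarrow> bump_in (f U) U"
    "\<And>U. U \<in> \<U> \<Longrightarrow> \<exists>y\<in>B. \<epsilon> \<le> norm (T (f U) y)" by metis
  \<comment> \<open>The strict inequality makes \<open>h U\<close> open, and halving \<epsilon>
    keeps the points where the value \<epsilon> is reached.\<close>
  define h where "h U = {y. \<epsilon> / 2 < norm (T (f U) y)}" for U
  have sum_le: "(\<Sum>U\<in>F. \<bar>f U x\<bar>) \<le> real \<kappa>" if "finite F" "F \<subseteq> \<U>" for F x
  proof -
    have "(\<Sum>U\<in>F. \<bar>f U x\<bar>) \<le> (\<Sum>U\<in>F. if x \<in> U then 1 else 0)"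
      using that(2) by (intro sum_mono) (auto simp: bump_inD[OF f(1)] subset_iff)
    also have "\<dots> = real (card {U \<in> F. x \<in> U})"
      using that(1) by (simp add: sum.If_cases Int_def)
    also have "\<dots> \<le> real (card {U \<in> \<U>. x \<in> U})"
      using \<U>(2) that(2) unfolding has_order_def by (intro of_nat_mono card_mono) auto
    also have "\<dots> \<le> real \<kappa>" using \<U>(2) by (simp add: has_order_def)
    finally show ?thesis .
  qed
  have open_h: "open (h U)" for U
    unfolding h_def by (intro open_Collect_less continuous_intros) auto
  have meet: "B \<inter> h U \<noteq> {}" if U: "U \<in> \<U>" for U
  proof -
    obtain y where "y \<in> B" "\<epsilon> \<le> norm (T (f U) y)" using f(2)[OF U] by blast
    then have "y \<in> B \<inter> h U" using \<epsilon> by (simp add: h_def)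
    then show ?thesis by blast
  qed
  have "nonempty_open_family (h ` \<U>)" "meeting (h ` \<U>) B"
    using open_h meet unfolding nonempty_open_family_def meeting_def by blast+
  moreover have "finite {U \<in> \<U>. y \<in> h U}" for y
  proof (rule finite_subset)
    show "finite {U \<in> \<U>. \<epsilon> / 2 \<le> norm (T (f U) y)}"
      using \<epsilon> sum_le by (intro finite_large_values) auto
  qed (auto simp: h_def)
  moreover have "bounded_combinations (\<lambda>U. T (f U) y) \<U> (b * real \<kappa>)" for y
    using sum_le by (rule bounded_combinations_T)
  moreover have "\<epsilon> / 2 \<le> norm (T (f U) y)" if "y \<in> h U" for U y
    using that by (simp add: h_def)
  ultimately show ?thesis by (intro exI[of _ f] exI[of _ h]) simp
qed

lemma c_pb_le_c_pf:
  assumes \<epsilon>: "0 < \<epsilon>"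
    and large: "\<And>U. open U \<Longrightarrow> A \<inter> U \<noteq> {} \<Longrightarrow> \<exists>f. bump_in f U \<and> (\<exists>y\<in>B. \<epsilon> \<le> norm (T f y))"
    and B: "infinite B"
  shows "c_pb A \<le>o c_pf B"
proof -
  let ?F = "{\<V>. nonempty_open_family \<V> \<and> point_finite \<V> \<and> meeting \<V> B}"
  obtain C where C: "c_pf B = |C|" and le: "\<And>\<V>. \<V> \<in> ?F \<Longrightarrow> |\<V>| \<le>o |C|"
    unfolding c_pf_def using card_sup_aux[of ?F] by (elim exE conjE) blast
  obtain \<U>0 where "infinite \<U>0" "\<U>0 \<in> ?F"
    using infinite_disjoint_open_family[OF compact_cod B]
    by (auto simp: point_bounded_def has_order_def point_finite_def)
  then have "infinite C" using card_of_ordLeq_infinite le by blast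
  show ?thesis
    unfolding C c_pb_def
  proof (rule card_sup_least)
    fix \<U> assume "\<U> \<in> {\<U>. nonempty_open_family \<U> \<and> point_bounded \<U> \<and> meeting \<U> A}"
    then obtain \<kappa> where \<U>: "nonempty_open_family \<U>" "has_order \<U> \<kappa>" "meeting \<U> A"
      by (auto simp: point_bounded_def)
    from bounded_family_transfer[OF \<epsilon> large \<U>] obtain h where
      h: "nonempty_open_family (h ` \<U>)" "meeting (h ` \<U>) B" "\<And>y. finite {U \<in> \<U>. y \<in> h U}"
      by blast
    have "finite {V \<in> h ` \<U>. y \<in> V}" for y
      by (rule finite_subset[of _ "h ` {U \<in> \<U>. y \<in> h U}"]) (use h(3) in auto)
    then have "h ` \<U> \<in> ?F" using h by (simp add: point_finite_def)
    from card_of_finite_fibres[OF \<open>infinite C\<close> le[OF this] finite_fibre[OF h(3,1)]]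
    show "|\<U>| \<le>o |C|" .
  qed
qed

text \<open>Beyond point-finiteness, cotype bounds the number of sets \<open>h U\<close> containing
  \<open>y\<close> by a constant that does not depend on \<open>y\<close>.\<close>

lemma c_pb_le_c_pb:
  assumes cotype: "nontrivial_cotype TYPE('e)" and \<epsilon>: "0 < \<epsilon>"
    and large: "\<And>U. open U \<Longrightarrow> A \<inter> U \<noteq> {} \<Longrightarrow> \<exists>f. bump_in f U \<and> (\<exists>y\<in>B. \<epsilon> \<le> norm (T f y))"
    and B: "infinite B"
  shows "c_pb A \<le>o c_pb B"
proof -
  let ?F = "{\<V>. nonempty_open_family \<V> \<and> point_bounded \<V> \<and> meeting \<V> B}"
  obtain C where C: "c_pb B = |C|" and le: "\<And>\<V>. \<V> \<in> ?F \<Longrightarrow> |\<V>| \<le>o |C|"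
    unfolding c_pb_def using card_sup_aux[of ?F] by (elim exE conjE) blast
  obtain \<U>0 where "infinite \<U>0" "\<U>0 \<in> ?F"
    using infinite_disjoint_open_family[OF compact_cod B] by auto
  then have "infinite C" using card_of_ordLeq_infinite le by blast
  show ?thesis
    unfolding C c_pb_def[of A]
  proof (rule card_sup_least)
    fix \<U> assume "\<U> \<in> {\<U>. nonempty_open_family \<U> \<and> point_bounded \<U> \<and> meeting \<U> A}"
    then obtain \<kappa> where \<U>: "nonempty_open_family \<U>" "has_order \<U> \<kappa>" "meeting \<U> A"
      by (auto simp: point_bounded_def)
    from bounded_family_transfer[OF \<epsilon> large \<U>] obtain f h where
      h: "nonempty_open_family (h ` \<U>)" "meeting (h ` \<U>) B" "\<And>y. finite {U \<in> \<U>. y \<in> h U}"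
      and low: "\<And>U y. U \<in> \<U> \<Longrightarrow> y \<in> h U \<Longrightarrow> \<epsilon> / 2 \<le> norm (T (f U) y)"
      and comb: "\<And>y. bounded_combinations (\<lambda>U. T (f U) y) \<U> (b * real \<kappa>)"
      by blast
    obtain M where M: "\<And>I (e :: 'a set \<Rightarrow> 'e). finite I \<Longrightarrow> (\<forall>i\<in>I. \<epsilon> / 2 \<le> norm (e i)) \<Longrightarrow>
        bounded_combinations e I (b * real \<kappa>) \<Longrightarrow> card I \<le> M"
      using nontrivial_cotype_card_bound[OF cotype half_gt_zero[OF \<epsilon>], of "b * real \<kappa>"] by blast
    \<comment> \<open>\<open>Suc M\<close> replaces \<open>M\<close> because an order must be
      positive.\<close>
    have "finite {V \<in> h ` \<U>. y \<in> V} \<and> card {V \<in> h ` \<U>. y \<in> V} \<le> Suc M" for y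
    proof -
      let ?I = "{U \<in> \<U>. y \<in> h U}"
      have eq: "{V \<in> h ` \<U>. y \<in> V} = h ` ?I" by auto
      have "bounded_combinations (\<lambda>U. T (f U) y) ?I (b * real \<kappa>)"
        using comb[of y] unfolding bounded_combinations_def by blast
      then have "card ?I \<le> M" using low by (intro M[OF h(3)]) auto
      then show ?thesis using card_image_le[OF h(3), of h y] h(3)[of y] unfolding eq by simp
    qed
    then have "point_bounded (h ` \<U>)"
      unfolding point_bounded_def has_order_def by (intro exI[of _ "Suc M"]) simp
    then have "h ` \<U> \<in> ?F" using h by simp
    from card_of_finite_fibres[OF \<open>infinite C\<close> le[OF this] finite_fibre[OF h(3,1)]]
    show "|\<U>| \<le>o |C|" .
  qed
qed

end

theorem theorem1p2:
  fixes T :: "('a::t2_space \<Rightarrow>\<^sub>C real) \<Rightarrow> ('b::t2_space \<Rightarrow>\<^sub>C 'e::banach)"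
    and \<alpha> :: "'o rel"
    and n k :: nat
  assumes "compact (UNIV :: 'a set)"
    and "compact (UNIV :: 'b set)"
    and "isomorphic_embedding_on UNIV T"
    and "Well_order \<alpha>"
    and "1 \<le> k" and "k \<le> n"
    and "infinite (cb_deriv (omega_power_times \<alpha> k) (UNIV :: 'b set))"
    and "(nontrivial_cotype TYPE('e) \<and>
           c_pb (cb_deriv (omega_power_times \<alpha> k) (UNIV :: 'b set))
             <o c_pb (cb_deriv (omega_power_times \<alpha> n) (UNIV :: 'a set))) \<or>
         (\<not> contains_copy_of_c0 TYPE('e) \<and>
           c_pf (cb_deriv (omega_power_times \<alpha> k) (UNIV :: 'b set))
             <o c_pb (cb_deriv (omega_power_times \<alpha> n) (UNIV :: 'a set)))"
  shows "onorm T * onorm_on (range T) (inv T) \<ge> max 3 ((2 * real n + 2 - real k) / real k)"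
proof (rule ccontr)
  let ?a = "onorm_on (range T) (inv T)" and ?b = "onorm T"
  let ?A = "cb_deriv (omega_power_times \<alpha> n) (UNIV :: 'a set)"
  let ?B = "cb_deriv (omega_power_times \<alpha> k) (UNIV :: 'b set)"
  assume "\<not> max 3 ((2 * real n + 2 - real k) / real k) \<le> ?b * ?a"
  then have small: "?b * ?a < 3 \<or> ?b * ?a < (2 * real n + 2 - real k) / real k" by auto
  have T: "bounded_linear T" "inj T" and "\<exists>C. \<forall>y\<in>range T. norm (inv T y) \<le> C * norm y"
    using assms(3) unfolding isomorphic_embedding_on_UNIV by blast+
  then obtain C where "\<forall>y\<in>range T. norm (inv T y) \<le> C * norm y" by blast
  then have C: "norm f \<le> C * norm (T f)" for f using T(2) by (metis inv_f_f rangeI)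
  \<comment> \<open>The supremum in \<open>onorm_on\<close> dominates the quotients only once they
    are known to be bounded above.\<close>
  have "norm (inv T y) / norm y \<le> \<bar>C\<bar>" if y: "y \<in> range T" for y
  proof (cases "y = 0")
    case False
    obtain f where f: "y = T f" using y by blast
    have "norm f \<le> \<bar>C\<bar> * norm (T f)" using C[of f] mult_right_mono[OF abs_ge_self norm_ge_zero, of C "T f"] by linarith
    then show ?thesis using False T(2) unfolding f by (simp add: divide_le_eq)
  qed simp
  then have bdd: "bdd_above ((\<lambda>y. norm (inv T y) / norm y) ` range T)" by (intro bdd_aboveI2)
  have upper: "norm (inv T y) / norm y \<le> ?a" if "y \<in> range T" for y
    unfolding onorm_on_def by (rule cSUP_upper[OF that bdd])
  have T0: "T 0 = 0" using linear_0[OF bounded_linear.linear[OF T(1)]] .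
  have a0: "0 \<le> ?a" using upper[of "T 0"] T0 by simp
  have a: "norm f \<le> ?a * norm (T f)" for f
  proof (cases "T f = 0")
    case True
    then have "f = 0" using injD[OF T(2), of f 0] T0 by simp
    then show ?thesis using T0 by simp
  next
    case False
    then show ?thesis using upper[of "T f"] T(2) by (simp add: divide_le_eq)
  qed
  interpret bounded_operator T ?b
  proof (rule bounded_operator.intro)
    show "norm (T f) \<le> ?b * norm f" for f by (rule onorm[OF T(1)])
    show "\<exists>i. norm (e i) < \<epsilon>" if \<epsilon>: "0 < \<epsilon>" and e: "bounded_combinations e UNIV B"
      for \<epsilon> B and e :: "nat \<Rightarrow> 'e"
    proof (rule ccontr)
      \<comment> \<open>Such a sequence yields a copy of \<open>c0\<close>, so the cotype
        alternative must hold; but cotype bounds the number of vectors, which \<open>M + 1\<close>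
        of them exceed.\<close>
      assume "\<not> ?thesis"
      then have low: "\<And>i. \<epsilon> \<le> norm (e i)" by (simp add: not_less)
      have "contains_copy_of_c0 TYPE('e)" by (rule bounded_combinations_imp_c0[OF e \<epsilon> low])
      then have "nontrivial_cotype TYPE('e)" using assms(8) by blast
      from nontrivial_cotype_card_bound[OF this \<epsilon>] obtain M where
        M: "\<And>I (e :: nat \<Rightarrow> 'e). finite I \<Longrightarrow> (\<forall>i\<in>I. \<epsilon> \<le> norm (e i)) \<Longrightarrow>
          bounded_combinations e I B \<Longrightarrow> card I \<le> M" by blast
      have "card {..M} \<le> M"
        using e low by (intro M[of _ e]) (auto simp: bounded_combinations_def)
      then show False by simp
    qed
  qed (use assms(1,2) bounded_linear.linear[OF T(1)] onorm_pos_le[OF T(1)] in simp_all)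
  note D = vanishing_omega_step[OF assms(4) subset_refl vanishing_omega_deriv[OF assms(4)]]
    derivation_op_omega_step[OF assms(4) subset_refl derivation_op_omega_deriv[OF assms(4)]]
  have "\<exists>\<epsilon>>0. \<forall>U. open U \<longrightarrow> ?A \<inter> U \<noteq> {} \<longrightarrow>
      (\<exists>f. bump_in f U \<and> (\<exists>y\<in>?B. \<epsilon> \<le> norm (T f y)))"
    \<comment> \<open>Each term of the maximum has its own coefficients: those of
      \<open>adjustable_three\<close> sum to 3 with bound 1, those of
      \<open>adjustable_ones_twos\<close> to \<open>2 * n + 2 - k\<close> with bound
      \<open>k\<close>.\<close>
    using small
  proof
    assume "?b * ?a < 3"
    moreover have "(\<Sum>i\<le>n. (if i = 0 then 1 else 0) + (if i = n then 2 else 0) :: real) = 3"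
      by (simp add: sum.distrib)
    ultimately show ?thesis
      unfolding cb_deriv_w[OF assms(4)]
      by (intro large_values_on_derivative[OF a0 a D adjustable_three[OF assms(5,6)]])
        (simp add: mult.commute)
  next
    assume "?b * ?a < (2 * real n + 2 - real k) / real k"
    then have "?a * (?b * real k) < 2 * real n + 2 - real k"
      using assms(5) by (simp add: field_simps)
    then show ?thesis
      unfolding cb_deriv_w[OF assms(4)]
      by (intro large_values_on_derivative[OF a0 a D adjustable_ones_twos])
        (simp only: sum_ones_twos[OF assms(6)])
  qed
  then obtain \<epsilon> where "0 < \<epsilon>" and large: "\<And>U. open U \<Longrightarrow> ?A \<inter> U \<noteq> {} \<Longrightarrow>
      \<exists>f. bump_in f U \<and> (\<exists>y\<in>?B. \<epsilon> \<le> norm (T f y))" by blast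
  show False
    using assms(8)
  proof
    assume *: "nontrivial_cotype TYPE('e) \<and> c_pb ?B <o c_pb ?A"
    then have "c_pb ?A \<le>o c_pb ?B"
      using \<open>0 < \<epsilon>\<close> large assms(7) by (intro c_pb_le_c_pb) auto
    then show False using * not_ordLess_ordLeq by blast
  next
    assume *: "\<not> contains_copy_of_c0 TYPE('e) \<and> c_pf ?B <o c_pb ?A"
    have "c_pb ?A \<le>o c_pf ?B"
      using \<open>0 < \<epsilon>\<close> large assms(7) by (intro c_pb_le_c_pf) auto
    then show False using * not_ordLess_ordLeq by blast
  qed
qed

end
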